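(* For a knot projection $P$ let $X(P)$ be the number of cross chords in the chord diagram $CD_P$ of $P$. Then: (1) $X(P)$ is invariant under the first homotopy moves; (2) $X(P)$ is changed by $\pm 3$ by a strong third homotopy move; (3) $X(P)$ is changed by $\pm 1$ by a weak third homotopy move. In particular, $X(P) \pmod 3$ is an invariant of knot projections under strong $(1,3)$ homotopy.
   Context: A knot projection is a generic immersed closed curve in $S^2$, i.e. the image of a smooth immersion of a circle in $S^2$ whose only self-intersections are transverse double points; knot projections are considered up to ambient isotopy of $S^2$. First homotopy move (flat first Reidemeister move): in a small disk, an embedded arc of the projection is replaced by an arc with exactly one double point bounding a $1$-gon (a kink), or conversely. Third homotopy move (flat third Reidemeister move): in a disk $D$ in which the projection consists of three arcs, pairwise crossing exactly once and bounding a triangle ($3$-gon face), one arc is pushed across the double point of the other two, so that the triangle is replaced by a new one. Orient the projection (either way). The third homotopy move is called strong if the three sides of the triangle are coherently oriented (they form a directed cycle), and weak otherwise; this does not depend on the chosen orientation nor on whether one looks at the triangle before or after the move. Strong $(1,3)$ homotopy is the equivalence relation on knot projections generated by the first homotopy moves and the strong third homotopy moves (and ambient isotopy of $S^2$). The chord diagram $CD_P$ of a knot projection $P$ is the parametrizing circle together with, for each double point of $P$, a chord joining its two preimages. A cross chord is a pair of chords of $CD_P$ that intersect each other (i.e. whose endpoints alternate on the circle). *)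

theory Defs
  imports "HOL-Analysis.Analysis"
begin

abbreviation S2 :: "(real^3) set" where
  "S2 \<equiv> sphere 0 1"

(* C^infinity on an open set of a finite-dimensional space: f is differentiable and all its
   directional derivatives are again smooth. *)
coinductive smooth_on_open :: "'a::euclidean_space set \<Rightarrow> ('a \<Rightarrow> 'b::real_normed_vector) \<Rightarrow> bool"
  for U where
  "(\<And>x. x \<in> U \<Longrightarrow> (f has_derivative F x) (at x)) \<Longrightarrow>
   (\<And>v. smooth_on_open U (\<lambda>x. F x v)) \<Longrightarrow> smooth_on_open U f"

(* Smooth maps on arbitrary subsets of Euclidean space: restrictions of smooth maps defined on an
   open neighbourhood. *)
definition smooth_on :: "'a::euclidean_space set \<Rightarrow> ('a \<Rightarrow> 'b::real_normed_vector) \<Rightarrow> bool" where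
  "smooth_on S f \<longleftrightarrow>
     (\<exists>U g. open U \<and> S \<subseteq> U \<and> smooth_on_open U g \<and> (\<forall>x\<in>S. g x = f x))"


section \<open>Knot projections and their chord diagrams\<close>

(* The parametrizing circle is R/Z; {0..<1} is a set of representatives of its points.  The last
   two conditions say that the self-intersections are transverse double points: no point has three
   preimages, and at two preimages of one point the velocities (both tangent to the sphere there)
   are linearly independent. *)
definition generic_immersion :: "(real \<Rightarrow> real^3) \<Rightarrow> bool" where
  "generic_immersion \<gamma> \<longleftrightarrow>
     smooth_on UNIV \<gamma> \<and>
     (\<forall>t. \<gamma> t \<in> S2) \<and>
     (\<forall>t. \<gamma> (t + 1) = \<gamma> t) \<and>
     (\<forall>t. vector_derivative \<gamma> (at t) \<noteq> 0) \<and>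
     (\<forall>r\<in>{0..<1}. \<forall>s\<in>{0..<1}. \<forall>t\<in>{0..<1}.
        \<gamma> r = \<gamma> s \<and> \<gamma> s = \<gamma> t \<longrightarrow> r = s \<or> s = t \<or> r = t) \<and>
     (\<forall>s\<in>{0..<1}. \<forall>t\<in>{0..<1}. s \<noteq> t \<and> \<gamma> s = \<gamma> t \<longrightarrow>
        \<not> collinear {0, vector_derivative \<gamma> (at s), vector_derivative \<gamma> (at t)})"

definition parametrizes :: "(real \<Rightarrow> real^3) \<Rightarrow> (real^3) set \<Rightarrow> bool" where
  "parametrizes \<gamma> P \<longleftrightarrow> generic_immersion \<gamma> \<and> range \<gamma> = P"

definition knot_projection :: "(real^3) set \<Rightarrow> bool" where
  "knot_projection P \<longleftrightarrow> (\<exists>\<gamma>. parametrizes \<gamma> P)"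

(* A chord is represented by the set of its two endpoints on the circle. *)
definition chords :: "(real \<Rightarrow> real^3) \<Rightarrow> real set set" where
  "chords \<gamma> = {{s, t} | s t. s \<in> {0..<1} \<and> t \<in> {0..<1} \<and> s \<noteq> t \<and> \<gamma> s = \<gamma> t}"

definition chords_intersect :: "real set \<Rightarrow> real set \<Rightarrow> bool" where
  "chords_intersect A B \<longleftrightarrow>
     (\<exists>p q r s. p < q \<and> q < r \<and> r < s \<and>
        (A = {p, r} \<and> B = {q, s} \<or> A = {q, s} \<and> B = {p, r}))"

definition cross_chords :: "(real \<Rightarrow> real^3) \<Rightarrow> real set set set" where
  "cross_chords \<gamma> = {{A, B} | A B. A \<in> chords \<gamma> \<and> B \<in> chords \<gamma> \<and> chords_intersect A B}"

(* The number of cross chords is the common value for all parametrizations of P. *)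
definition cross_chord_number :: "(real^3) set \<Rightarrow> nat" where
  "cross_chord_number P = (THE n. \<forall>\<gamma>. parametrizes \<gamma> P \<longrightarrow> card (cross_chords \<gamma>) = n)"


section \<open>Ambient isotopy\<close>

(* H is a smooth isotopy of diffeomorphisms of the sphere, starting at the identity. *)
definition ambient_isotopic :: "(real^3) set \<Rightarrow> (real^3) set \<Rightarrow> bool" where
  "ambient_isotopic P Q \<longleftrightarrow>
     knot_projection P \<and> knot_projection Q \<and>
     (\<exists>H :: real \<Rightarrow> real^3 \<Rightarrow> real^3.
        smooth_on ({0..1} \<times> S2) (\<lambda>(t, x). H t x) \<and>
        (\<forall>t\<in>{0..1}. bij_betw (H t) S2 S2 \<and> smooth_on S2 (inv_into S2 (H t))) \<and>
        (\<forall>x\<in>S2. H 0 x = x) \<and>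
        H 1 ` P = Q)"

definition up_to_isotopy ::
  "((real^3) set \<Rightarrow> (real^3) set \<Rightarrow> bool) \<Rightarrow> (real^3) set \<Rightarrow> (real^3) set \<Rightarrow> bool" where
  "up_to_isotopy R P P' \<longleftrightarrow>
     (\<exists>Q Q'. ambient_isotopic P Q \<and> R Q Q' \<and> ambient_isotopic Q' P')"


section \<open>Homotopy moves\<close>

(* D is a closed disk in the sphere, with boundary circle B. *)
definition disk_with_boundary :: "(real^3) set \<Rightarrow> (real^3) set \<Rightarrow> bool" where
  "disk_with_boundary D B \<longleftrightarrow>
     D \<subseteq> S2 \<and>
     (\<exists>h k. homeomorphism (cball (0::complex) 1) D h k \<and> B = h ` sphere 0 1)"

(* Restricted to [a, b], the curve runs through D from boundary to boundary. *)
definition proper_strand ::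
  "(real \<Rightarrow> real^3) \<Rightarrow> (real^3) set \<Rightarrow> (real^3) set \<Rightarrow> real \<Rightarrow> real \<Rightarrow> bool" where
  "proper_strand \<gamma> D B a b \<longleftrightarrow> a < b \<and> \<gamma> a \<in> B \<and> \<gamma> b \<in> B \<and> \<gamma> ` {a<..<b} \<subseteq> D - B"

(* Inside D an embedded arc is replaced by an arc with exactly one double point.  The loop of the
   new arc then bounds a 1-gon face, because nothing else of the projection meets D.  That the disk
   misses the base point 0 of the circle is no restriction, by a shift of the parameter. *)
definition kink_creation :: "(real^3) set \<Rightarrow> (real^3) set \<Rightarrow> bool" where
  "kink_creation P P' \<longleftrightarrow>
     (\<exists>\<gamma> \<gamma>' D B a b.
        parametrizes \<gamma> P \<and> parametrizes \<gamma>' P' \<and> disk_with_boundary D B \<and>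
        0 < a \<and> b < 1 \<and>
        {t \<in> {0..1}. \<gamma> t \<in> D} = {a..b} \<and> proper_strand \<gamma> D B a b \<and>
        {t \<in> {0..1}. \<gamma>' t \<in> D} = {a..b} \<and> proper_strand \<gamma>' D B a b \<and>
        (\<forall>t\<in>{0..1} - {a<..<b}. \<gamma>' t = \<gamma> t) \<and>
        inj_on \<gamma> {a..b} \<and>
        (\<exists>c d. a < c \<and> c < d \<and> d < b \<and> \<gamma>' c = \<gamma>' d \<and>
           (\<forall>s\<in>{a..b}. \<forall>t\<in>{a..b}. s < t \<and> \<gamma>' s = \<gamma>' t \<longrightarrow> s = c \<and> t = d)))"

definition first_move :: "(real^3) set \<Rightarrow> (real^3) set \<Rightarrow> bool" where
  "first_move = up_to_isotopy (\<lambda>Q Q'. kink_creation Q Q' \<or> kink_creation Q' Q)"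

(* Inside D the projection consists of the three embedded arcs \<gamma> ` {a i..b i}, i < 3, which
   pairwise cross exactly once.  The three crossings are distinct, as a generic immersion has no
   triple points, and the segments between them bound a triangle face, because nothing else of the
   projection meets D. *)
definition three_strands ::
  "(real \<Rightarrow> real^3) \<Rightarrow> (real^3) set \<Rightarrow> (real^3) set \<Rightarrow> (nat \<Rightarrow> real) \<Rightarrow> (nat \<Rightarrow> real) \<Rightarrow> bool"
where
  "three_strands \<gamma> D B a b \<longleftrightarrow>
     0 < a 0 \<and> b 0 < a 1 \<and> b 1 < a 2 \<and> b 2 < 1 \<and>
     {t \<in> {0..1}. \<gamma> t \<in> D} = (\<Union>i<3. {a i..b i}) \<and>
     (\<forall>i<3. proper_strand \<gamma> D B (a i) (b i) \<and> inj_on \<gamma> {a i..b i}) \<and>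
     (\<forall>i<3. \<forall>j<3. i \<noteq> j \<longrightarrow> (\<exists>p\<in>D - B. \<gamma> ` {a i..b i} \<inter> \<gamma> ` {a j..b j} = {p}))"

(* Outside strand number 2 the curves \<gamma> and \<gamma>' agree; strand 2 is pushed across the double point p
   of the strands 0 and 1.  A properly embedded arc cuts D into two sides, each of them containing
   one of the two arcs into which its endpoints divide B; pushing across p means that p changes
   from the side containing z to the other one, for every z on B off the endpoints.  Taking the
   pushed strand last is no restriction, by a shift of the parameter. *)
definition strand_pushed ::
  "(real \<Rightarrow> real^3) \<Rightarrow> (real \<Rightarrow> real^3) \<Rightarrow> (real^3) set \<Rightarrow> (real^3) set \<Rightarrow>
   (nat \<Rightarrow> real) \<Rightarrow> (nat \<Rightarrow> real) \<Rightarrow> bool"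
where
  "strand_pushed \<gamma> \<gamma>' D B a b \<longleftrightarrow>
     disk_with_boundary D B \<and> three_strands \<gamma> D B a b \<and> three_strands \<gamma>' D B a b \<and>
     (\<forall>t\<in>{0..1} - {a 2<..<b 2}. \<gamma>' t = \<gamma> t) \<and>
     (\<forall>p\<in>\<gamma> ` {a 0..b 0} \<inter> \<gamma> ` {a 1..b 1}. \<forall>z\<in>B - {\<gamma> (a 2), \<gamma> (b 2)}.
        connected_component (D - \<gamma>' ` {a 2..b 2}) p z \<longleftrightarrow>
        \<not> connected_component (D - \<gamma> ` {a 2..b 2}) p z)"

(* The parameter at which strand i crosses strand j. *)
definition crossing_time ::
  "(real \<Rightarrow> real^3) \<Rightarrow> (nat \<Rightarrow> real) \<Rightarrow> (nat \<Rightarrow> real) \<Rightarrow> nat \<Rightarrow> nat \<Rightarrow> real" where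
  "crossing_time \<gamma> a b i j = (THE t. t \<in> {a i..b i} \<and> \<gamma> t \<in> \<gamma> ` {a j..b j})"

(* With v_ij the common vertex of the sides on the strands i and j, the two disjuncts are the
   directed cycles v_01 -> v_02 -> v_12 -> v_01 and its reverse, the three sides being those on the
   strands 0, 2, 1, oriented by increasing parameter. *)
definition coherent_triangle ::
  "(real \<Rightarrow> real^3) \<Rightarrow> (nat \<Rightarrow> real) \<Rightarrow> (nat \<Rightarrow> real) \<Rightarrow> bool" where
  "coherent_triangle \<gamma> a b \<longleftrightarrow>
     (let \<tau> = crossing_time \<gamma> a b in
        (\<tau> 0 1 < \<tau> 0 2 \<and> \<tau> 2 0 < \<tau> 2 1 \<and> \<tau> 1 2 < \<tau> 1 0) \<or>
        (\<tau> 0 2 < \<tau> 0 1 \<and> \<tau> 2 1 < \<tau> 2 0 \<and> \<tau> 1 0 < \<tau> 1 2))"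

definition strong_third_move :: "(real^3) set \<Rightarrow> (real^3) set \<Rightarrow> bool" where
  "strong_third_move = up_to_isotopy (\<lambda>Q Q'. \<exists>\<gamma> \<gamma>' D B a b.
     parametrizes \<gamma> Q \<and> parametrizes \<gamma>' Q' \<and> strand_pushed \<gamma> \<gamma>' D B a b \<and>
     coherent_triangle \<gamma> a b)"

definition weak_third_move :: "(real^3) set \<Rightarrow> (real^3) set \<Rightarrow> bool" where
  "weak_third_move = up_to_isotopy (\<lambda>Q Q'. \<exists>\<gamma> \<gamma>' D B a b.
     parametrizes \<gamma> Q \<and> parametrizes \<gamma>' Q' \<and> strand_pushed \<gamma> \<gamma>' D B a b \<and>
     \<not> coherent_triangle \<gamma> a b)"

definition strong_13_homotopic :: "(real^3) set \<Rightarrow> (real^3) set \<Rightarrow> bool" where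
  "strong_13_homotopic P Q \<longleftrightarrow>
     knot_projection P \<and> knot_projection Q \<and>
     equivclp (\<lambda>P Q. ambient_isotopic P Q \<or> first_move P Q \<or> strong_third_move P Q) P Q"

end

theory Submission
  imports Defs "HOL-Complex_Analysis.Winding_Numbers"
begin

text \<open>
  The number of cross chords of a projection is defined through an arbitrary parametrization, so its
  independence of the parametrization comes first. Record with every point of a generic curve the
  tangent line there. Transversality makes the lifted curve a simple closed curve, and since tangent
  lines are limits of secants, the image of the lift is determined by the projection alone
  (\<open>range_lift_mono\<close>). Two chords cross if and only if the end points of one of them, removed from the
  lifted curve, separate the end points of the other (\<open>chords_intersect_iff_linked\<close>). This is a
  topological property of the image, so the number of cross chords is well defined
  (\<open>card_cross_chords_range\<close>). An ambient isotopy carries a parametrization to a curve with the same chords.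

  A first move adds or removes one chord that crosses no other chord. For a third move let the three
  strands, in the order in which they are traversed, be 0, 1, 2, and let \<open>\<tau> i j\<close> be the time at which strand
  \<open>i\<close> crosses strand \<open>j\<close>. Chords outside the disk are not affected, and whether they cross one of the three
  chords of the triangle depends only on the strands involved. Among the three chords themselves, the
  number of cross chords is the number of valid inequalities among
  \<open>\<tau> 0 1 < \<tau> 0 2\<close>, \<open>\<tau> 1 2 < \<tau> 1 0\<close>, \<open>\<tau> 2 0 < \<tau> 2 1\<close> (\<open>card_cross_chords_formula\<close>). The triangle is coherent if
  and only if all or none of them hold, and the move reverses all three. Hence the number changes between
  0 and 3 in the strong case and between 1 and 2 in the weak case.

  The reversal on strands 0 and 1 expresses that strand 2 passes across their crossing point. The reversal
  on strand 2 needs planarity, in the form that strand 1 separates the ends of strand 0 in the disk, and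
  conversely (\<open>transverse_arc_separates_disk\<close>). To see this, project stereographically to the plane. If
  the ends of one arc could be joined off the other arc, one would obtain a loop in the disk that crosses
  the other arc exactly once, transversally. Its winding numbers about the two ends of that arc would then be
  different (\<open>winding_number_changes_at_crossing\<close>), but both are zero, as these ends lie on the boundary
  of the disk (\<open>winding_number_disk_boundary\<close>).
\<close>

section \<open>Winding numbers at a transverse crossing\<close>

lemma path_subpath_continuous_on:
  fixes g :: "real \<Rightarrow> 'a::real_normed_vector"
  assumes "continuous_on {u..v} g" "u \<le> v"
  shows "path (subpath u v g)"
proof -
  have "(v - u) * x + u \<in> {u..v}" if "x \<in> {0..1}" for x
    using that assms(2) mult_left_le[of x "v - u"] by auto
  then show ?thesis
    unfolding path_def subpath_def
    by (intro continuous_on_compose2[OF assms(1)] continuous_intros) auto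
qed

text \<open>
  Near the crossing the two arcs are close to the axes of a cross centred at \<open>p\<close>, at the scale \<open>e\<close>.
  Closing the small piece of \<open>b\<close> by two segments \<open>K\<close> through a point above the cross gives a
  triangle, up to homotopy: its winding number is positive about the upper end of \<open>a\<close> and zero about
  the lower end. The rest of the loop, closed by \<open>K\<close> in the opposite direction, does not meet \<open>a\<close>,
  so it winds equally often about both ends.
\<close>
lemma winding_number_changes_at_crossing:
  fixes a b :: "real \<Rightarrow> complex"
  assumes e: "e > 0"
    and cont: "continuous_on {s - e..s + e} b" "continuous_on {t - e..t + e} a"
    and b: "\<And>x. \<bar>x - s\<bar> \<le> e \<Longrightarrow> norm (b x - p - of_real (x - s)) \<le> \<bar>x - s\<bar> / 8"
    and a: "\<And>x. \<bar>x - t\<bar> \<le> e \<Longrightarrow> norm (a x - p - \<i> * of_real (x - t)) \<le> \<bar>x - t\<bar> / 8"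
    and R: "path R" "pathstart R = b (s + e)" "pathfinish R = b (s - e)"
           "path_image R \<inter> a ` {t - e..t + e} = {}"
  shows "winding_number (subpath (s - e) (s + e) b +++ R) (a (t + e)) \<noteq>
         winding_number (subpath (s - e) (s + e) b +++ R) (a (t - e))"
proof -
  define m where "m = p + 3 * \<i> * of_real e"
  define w1 where "w1 = b (s - e)"
  define w2 where "w2 = b (s + e)"
  define K where "K = linepath w2 m +++ linepath m w1"
  define \<beta> where "\<beta> = subpath (s - e) (s + e) b"
  have B: "Re (b x) - Re p \<le> x - s + e / 8" "Re (b x) - Re p \<ge> x - s - e / 8"
      "Im (b x) - Im p \<le> e / 8" "Im (b x) - Im p \<ge> - e / 8"
    if "\<bar>x - s\<bar> \<le> e" for x
    using b[OF that] that abs_Re_le_cmod[of "b x - p - of_real (x - s)"]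
      abs_Im_le_cmod[of "b x - p - of_real (x - s)"] by (auto simp: abs_le_iff)
  have A: "Re (a x) - Re p \<le> e / 8" "Re (a x) - Re p \<ge> - e / 8"
      "Im (a x) - Im p \<le> x - t + e / 8" "Im (a x) - Im p \<ge> x - t - e / 8"
    if "\<bar>x - t\<bar> \<le> e" for x
    using a[OF that] that abs_Re_le_cmod[of "a x - p - \<i> * of_real (x - t)"]
      abs_Im_le_cmod[of "a x - p - \<i> * of_real (x - t)"] by (auto simp: abs_le_iff)
  have w: "Re w1 - Re p \<le> - e + e / 8" "Re w1 - Re p \<ge> - e - e / 8"
      "Im w1 - Im p \<le> e / 8" "Im w1 - Im p \<ge> - e / 8"
      "Re w2 - Re p \<le> e + e / 8" "Re w2 - Re p \<ge> e - e / 8"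
      "Im w2 - Im p \<le> e / 8" "Im w2 - Im p \<ge> - e / 8"
    using B[of "s - e"] B[of "s + e"] e by (auto simp: w1_def w2_def)
  have z: "Re (a (t + e)) - Re p \<le> e / 8" "Re (a (t + e)) - Re p \<ge> - e / 8"
      "Im (a (t + e)) - Im p \<le> e + e / 8" "Im (a (t + e)) - Im p \<ge> e - e / 8"
      "Im (a (t - e)) - Im p \<le> - e + e / 8"
    using A[of "t - e"] A[of "t + e"] e by auto
  have \<beta>: "path \<beta>" "pathstart \<beta> = w1" "pathfinish \<beta> = w2" "path_image \<beta> = b ` {s - e..s + e}"
    unfolding \<beta>_def w1_def w2_def using e cont(1)
    by (auto simp: path_image_subpath intro!: path_subpath_continuous_on)
  have K: "path K" "pathstart K = w2" "pathfinish K = w1"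
    by (auto simp: K_def)
  \<comment> \<open>Each segment of \<open>K\<close> lies in a half plane bounded by a line of slope 3 or -3 that passes above
    the whole of the arc \<open>a\<close>.\<close>
  have miss: "path_image K \<inter> a ` {t - e..t + e} = {}"
  proof -
    have off: "3 * Re (x - p) + Im (x - p) < 2 * e" "- 3 * Re (x - p) + Im (x - p) < 2 * e"
      if x: "x \<in> a ` {t - e..t + e}" for x
    proof -
      obtain y where y: "x = a y" "- e \<le> y - t" "y - t \<le> e" using x by force
      then have "\<bar>y - t\<bar> \<le> e" by linarith
      from A[OF this] y e show "3 * Re (x - p) + Im (x - p) < 2 * e" "- 3 * Re (x - p) + Im (x - p) < 2 * e"
        by simp_all
    qed
    have c1: "convex {x. 2 * e \<le> 3 * Re (x - p) + Im (x - p)}"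
      and c2: "convex {x. 2 * e \<le> - 3 * Re (x - p) + Im (x - p)}"
    proof -
      have "{x. 2 * e \<le> 3 * Re (x - p) + Im (x - p)} = {x. (Complex 3 1) \<bullet> x \<ge> 2 * e + 3 * Re p + Im p}"
        "{x. 2 * e \<le> - 3 * Re (x - p) + Im (x - p)} = {x. (Complex (-3) 1) \<bullet> x \<ge> 2 * e - 3 * Re p + Im p}"
        by (auto simp: inner_complex_def algebra_simps)
      then show "convex {x. 2 * e \<le> 3 * Re (x - p) + Im (x - p)}"
        "convex {x. 2 * e \<le> - 3 * Re (x - p) + Im (x - p)}"
        by (simp_all only: convex_halfspace_ge)
    qed
    have "closed_segment w2 m \<subseteq> {x. 2 * e \<le> 3 * Re (x - p) + Im (x - p)}"
      by (rule closed_segment_subset[OF _ _ c1]) (use w e in \<open>auto simp: m_def\<close>)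
    moreover have "closed_segment m w1 \<subseteq> {x. 2 * e \<le> - 3 * Re (x - p) + Im (x - p)}"
      by (rule closed_segment_subset[OF _ _ c2]) (use w e in \<open>auto simp: m_def\<close>)
    ultimately have "path_image K \<subseteq> {x. 2 * e \<le> 3 * Re (x - p) + Im (x - p)} \<union>
        {x. 2 * e \<le> - 3 * Re (x - p) + Im (x - p)}"
      by (auto simp: K_def path_image_join)
    then show ?thesis using off by fastforce
  qed
  have a_mem: "a (t + e) \<in> a ` {t - e..t + e}" "a (t - e) \<in> a ` {t - e..t + e}"
    using e by auto
  \<comment> \<open>The piece of \<open>b\<close> and its chord lie in a convex strip that avoids both ends of \<open>a\<close>, so within
    it one is deformed into the other.\<close>
  define S where "S = {x. Im x \<le> e / 8 + Im p} \<inter> {x. Im x \<ge> - e / 8 + Im p}"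
  have "S = {x. \<i> \<bullet> x \<le> e / 8 + Im p} \<inter> {x. \<i> \<bullet> x \<ge> - e / 8 + Im p}"
    by (auto simp: S_def inner_complex_def)
  then have S: "convex S"
    by (simp only: convex_Int convex_halfspace_ge convex_halfspace_le)
  have strip: "path_image \<beta> \<union> closed_segment w1 w2 \<subseteq> S"
  proof -
    have "b y \<in> S" if "y \<in> {s - e..s + e}" for y
    proof -
      have "\<bar>y - s\<bar> \<le> e" using that by (auto simp: abs_le_iff)
      from B[OF this] show ?thesis by (auto simp: S_def)
    qed
    then have "path_image \<beta> \<subseteq> S" unfolding \<beta> by blast
    moreover have "closed_segment w1 w2 \<subseteq> S"
      by (rule closed_segment_subset[OF _ _ S]) (use w in \<open>auto simp: S_def\<close>)
    ultimately show ?thesis by blast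
  qed
  have off: "z \<notin> S" if "z \<in> {a (t + e), a (t - e)}" for z
    using z e that by (auto simp: S_def)
  have arc_off: "z \<notin> path_image \<beta> \<union> closed_segment w1 w2" if "z \<in> {a (t + e), a (t - e)}" for z
    using strip off[OF that] by blast
  have tri: "winding_number (subpath (s - e) (s + e) b +++ R) z =
      winding_number (linepath w1 w2) z + winding_number K z + winding_number (R +++ reversepath K) z"
    if z: "z \<in> {a (t + e), a (t - e)}" for z
  proof -
    have zR: "z \<notin> path_image R" "z \<notin> path_image K" using z a_mem R(4) miss by auto
    have "homotopic_paths (-{z}) \<beta> (linepath w1 w2)"
    proof (rule homotopic_paths_linear)
      fix u :: real assume u: "u \<in> {0..1}"
      have "\<beta> u \<in> path_image \<beta>" "linepath w1 w2 u \<in> closed_segment w1 w2"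
        using u by (auto simp: path_image_def linepath_in_path)
      then have "closed_segment (\<beta> u) (linepath w1 w2 u) \<subseteq> S"
        by (intro closed_segment_subset[OF _ _ S]) (use strip in auto)
      then show "closed_segment (\<beta> u) (linepath w1 w2 u) \<subseteq> - {z}"
        using off[OF z] by blast
    qed (use \<beta> in auto)
    then have 1: "winding_number \<beta> z = winding_number (linepath w1 w2) z"
      by (rule winding_number_homotopic_paths)
    have 2: "winding_number (\<beta> +++ R) z = winding_number \<beta> z + winding_number R z"
      using \<beta> R zR arc_off[OF z] by (intro winding_number_join) (auto simp: w2_def)
    have 3: "winding_number (R +++ reversepath K) z = winding_number R z - winding_number K z"
      using K R zR by (subst winding_number_join) (auto simp: w1_def winding_number_reversepath)
    show ?thesis using 1 2 3 by (simp add: \<beta>_def)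
  qed
  have const: "winding_number (R +++ reversepath K) (a (t + e)) = winding_number (R +++ reversepath K) (a (t - e))"
  proof (rule winding_number_eq[where S = "a ` {t - e..t + e}"])
    show "connected (a ` {t - e..t + e})"
      by (intro connected_continuous_image cont) auto
    show "a ` {t - e..t + e} \<inter> path_image (R +++ reversepath K) = {}"
      using R(4) miss K R by (auto simp: path_image_join w1_def)
  qed (use a_mem R K in \<open>auto simp: w1_def w2_def\<close>)
  have below: "winding_number (linepath w1 w2) (a (t - e)) + winding_number K (a (t - e)) = 0"
  proof -
    have cvx: "convex {x. Im (x - p) \<ge> - e / 8}"
    proof -
      have "{x. Im (x - p) \<ge> - e / 8} = {x. \<i> \<bullet> x \<ge> - e / 8 + Im p}"
        by (auto simp: inner_complex_def)
      then show ?thesis by (simp only: convex_halfspace_ge)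
    qed
    have sub: "path_image (linepath w1 w2 +++ K) \<subseteq> {x. Im (x - p) \<ge> - e / 8}"
    proof -
      have "closed_segment x y \<subseteq> {x. Im (x - p) \<ge> - e / 8}" if "x \<in> {w1, w2, m}" "y \<in> {w1, w2, m}" for x y
        by (rule closed_segment_subset[OF _ _ cvx]) (use that w e in \<open>auto simp: m_def\<close>)
      then show ?thesis
        using subset_path_image_join[of "linepath w1 w2" _ K] subset_path_image_join
        by (auto simp: K_def path_image_join)
    qed
    have "winding_number (linepath w1 w2 +++ K) (a (t - e)) = 0"
      by (rule winding_number_zero_outside[OF _ cvx _ _ sub]) (use K z e in auto)
    moreover have "winding_number (linepath w1 w2 +++ K) (a (t - e)) =
        winding_number (linepath w1 w2) (a (t - e)) + winding_number K (a (t - e))"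
      using K arc_off miss a_mem by (intro winding_number_join) auto
    ultimately show ?thesis by simp
  qed
  \<comment> \<open>The upper end of \<open>a\<close> lies to the left of each of the three directed edges, so each edge
    contributes a positive angle.\<close>
  have above: "Re (winding_number (linepath w1 w2) (a (t + e)) + winding_number K (a (t + e))) > 0"
  proof -
    define z' where "z' = a (t + e) - p"
    define u1 where "u1 = w1 - p"
    define u2 where "u2 = w2 - p"
    have mp: "m - p = 3 * \<i> * of_real e" by (simp add: m_def)
    have bd: "Re u1 \<le> - e + e / 8" "Re u1 \<ge> - e - e / 8" "Im u1 \<le> e / 8" "Im u1 \<ge> - e / 8"
      "Re u2 \<le> e + e / 8" "Re u2 \<ge> e - e / 8" "Im u2 \<le> e / 8" "Im u2 \<ge> - e / 8"
      "Re z' \<le> e / 8" "Re z' \<ge> - e / 8" "Im z' \<le> e + e / 8" "Im z' \<ge> e - e / 8"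
      using w z by (auto simp: u1_def u2_def z'_def)
    have prod: "\<bar>x * y\<bar> \<le> c * d * (e * e)" if "\<bar>x\<bar> \<le> c * e" "\<bar>y\<bar> \<le> d * e" "c \<ge> 0" "d \<ge> 0" for x y c d
    proof -
      have "\<bar>x\<bar> * \<bar>y\<bar> \<le> (c * e) * (d * e)" using that e by (intro mult_mono) auto
      then show ?thesis by (simp add: abs_mult algebra_simps)
    qed
    have prod2: "x * y \<ge> c * d * (e * e)" if "x \<ge> c * e" "y \<ge> d * e" "c \<ge> 0" "d \<ge> 0" for x y c d
    proof -
      have "0 \<le> c * e" "0 \<le> d * e" using that e by auto
      then have "x * y \<ge> (c * e) * (d * e)" using that by (intro mult_mono) linarith+
      then show ?thesis by (simp add: algebra_simps)
    qed
    have ee: "e * e > 0" using e by simp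
    have 1: "0 < Re (winding_number (linepath w1 w2) (a (t + e)))"
    proof (rule winding_number_linepath_pos_lt)
      have "Im ((w2 - w1) * cnj (w2 - a (t + e))) = 
        Im (u2 - u1) * Re (u2 - z') + Re (u2 - u1) * Im (z' - u2)"
        by (simp add: u1_def u2_def z'_def algebra_simps)
      moreover have "\<bar>Im (u2 - u1) * Re (u2 - z')\<bar> \<le> (1/4) * (5/4) * (e * e)"
        by (rule prod) (use bd in \<open>simp_all only: abs_le_iff minus_complex.sel, linarith+\<close>)
      moreover have "Re (u2 - u1) * Im (z' - u2) \<ge> (7/4) * (3/4) * (e * e)"
        by (rule prod2) (use bd in \<open>auto simp: abs_le_iff\<close>)
      ultimately show "0 < Im ((w2 - w1) * cnj (w2 - a (t + e)))" using ee by linarith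
    qed
    have 2: "0 < Re (winding_number (linepath w2 m) (a (t + e)))"
    proof (rule winding_number_linepath_pos_lt)
      have eq: "m - w2 = 3 * \<i> * of_real e - u2" "m - a (t + e) = 3 * \<i> * of_real e - z'"
        by (simp_all add: m_def u2_def z'_def)
      have "Im ((m - w2) * cnj (m - a (t + e))) = 
        - ((3 * e - Im u2) * Re z') + Re u2 * (3 * e - Im z')"
        unfolding eq by (simp add: algebra_simps)
      moreover have "\<bar>(3 * e - Im u2) * Re z'\<bar> \<le> (25/8) * (1/8) * (e * e)"
        by (rule prod) (use bd e in \<open>auto simp: abs_le_iff\<close>)
      moreover have "Re u2 * (3 * e - Im z') \<ge> (7/8) * (15/8) * (e * e)"
        by (rule prod2) (use bd in \<open>auto simp: abs_le_iff\<close>)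
      ultimately show "0 < Im ((m - w2) * cnj (m - a (t + e)))" using ee by linarith
    qed
    have 3: "0 < Re (winding_number (linepath m w1) (a (t + e)))"
    proof (rule winding_number_linepath_pos_lt)
      have eq: "w1 - m = u1 - 3 * \<i> * of_real e" "w1 - a (t + e) = u1 - z'"
        by (simp_all add: m_def u1_def z'_def)
      have "Im ((w1 - m) * cnj (w1 - a (t + e))) = 
        (3 * e - Im u1) * Re (z' - u1) - (- Re u1) * Im (z' - u1)"
        unfolding eq by (simp add: algebra_simps)
      moreover have "(3 * e - Im u1) * Re (z' - u1) \<ge> (23/8) * (3/4) * (e * e)"
        by (rule prod2) (use bd in \<open>auto simp: abs_le_iff\<close>)
      moreover have "\<bar>(- Re u1) * Im (z' - u1)\<bar> \<le> (9/8) * (5/4) * (e * e)"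
        by (rule prod) (use bd e in \<open>auto simp: abs_le_iff\<close>)
      ultimately show "0 < Im ((w1 - m) * cnj (w1 - a (t + e)))" using ee by linarith
    qed
    have "a (t + e) \<notin> closed_segment w2 m" "a (t + e) \<notin> closed_segment m w1"
      using miss a_mem by (auto simp: K_def path_image_join)
    then have "winding_number K (a (t + e)) =
      winding_number (linepath w2 m) (a (t + e)) + winding_number (linepath m w1) (a (t + e))"
      unfolding K_def by (intro winding_number_join) auto
    then show ?thesis using 1 2 3 by simp
  qed
  show ?thesis
  proof
    assume "winding_number (subpath (s - e) (s + e) b +++ R) (a (t + e)) =
         winding_number (subpath (s - e) (s + e) b +++ R) (a (t - e))"
    then have "winding_number (linepath w1 w2) (a (t + e)) + winding_number K (a (t + e)) = 0"
      using tri[of "a (t + e)"] tri[of "a (t - e)"] const below by simp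
    then show False using above by simp
  qed
qed

section \<open>Transverse arcs separate a disk\<close>

text \<open>
  By invariance of domain, an interior point of \<open>D\<close> corresponds to an interior point of the model
  ball.
\<close>
lemma disk_boundary_not_interior:
  fixes D :: "'a::euclidean_space set"
  assumes hom: "homeomorphism (cball (0::'a) 1) D h k" and u: "u \<in> h ` sphere 0 1"
  shows "u \<notin> interior D"
proof
  assume "u \<in> interior D"
  have hk: "k ` D = cball 0 1" "continuous_on D k" "\<And>x. x \<in> cball 0 1 \<Longrightarrow> k (h x) = x"
      "\<And>y. y \<in> D \<Longrightarrow> h (k y) = y"
    using hom by (auto simp: homeomorphism_def)
  have "inj_on k (interior D)"
    by (rule inj_on_inverseI[where g = h]) (use hk(4) interior_subset in blast)
  then have "open (k ` interior D)"
    using hk(2) by (intro invariance_of_domain) (auto intro: continuous_on_subset[OF _ interior_subset])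
  moreover have "k ` interior D \<subseteq> cball 0 1"
    using hk(1) interior_subset by blast
  ultimately have "k ` interior D \<subseteq> ball 0 1"
    using interior_maximal[of "k ` interior D" "cball 0 1"] by (simp add: interior_cball)
  moreover obtain x where "x \<in> sphere 0 1" "u = h x" using u by auto
  ultimately have "k u \<in> ball 0 1" "k u = x" using \<open>u \<in> interior D\<close> hk(3)[of x] by auto
  then show False using \<open>x \<in> sphere 0 1\<close> by auto
qed

text \<open>
  A disk does not separate the plane, so a loop inside it winds around no point outside it. A
  boundary point is a limit of outside points, and winding numbers are locally constant.
\<close>
lemma winding_number_disk_boundary:
  fixes D :: "complex set"
  assumes hom: "homeomorphism (cball (0::complex) 1) D h k" and u: "u \<in> h ` sphere 0 1"
    and L: "path L" "pathfinish L = pathstart L" "path_image L \<subseteq> D" "u \<notin> path_image L"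
  shows "winding_number L u = 0"
proof -
  have "D homeomorphic cball (0::complex) 1"
    using hom unfolding homeomorphic_def by (blast intro: homeomorphism_symD)
  then have "connected (- D)"
    by (rule connected_complement_homeomorphic_convex_compact) auto
  moreover have "bounded D"
    using hom compact_continuous_image[of "cball 0 1" h] by (auto simp: homeomorphism_def intro: compact_imp_bounded)
  ultimately have "outside D = - D"
    using inside_bounded_complement_connected_empty[of D] inside_Un_outside[of D] by simp
  then have 0: "winding_number L x = 0" if "x \<notin> D" for x
    using that outside_mono[OF L(3)] L by (intro winding_number_zero_in_outside) auto
  have "open (- path_image L)"
    using L(1) closed_path_image by blast
  then obtain r where r: "r > 0" "ball u r \<subseteq> - path_image L"
    using L(4) by (auto simp: open_contains_ball)
  have "\<not> ball u r \<subseteq> D"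
    using disk_boundary_not_interior[OF hom u] r(1) by (auto simp: mem_interior)
  then obtain x where x: "x \<in> ball u r" "x \<notin> D" by blast
  have "winding_number L u = winding_number L x"
    by (rule winding_number_eq[where S = "ball u r"]) (use L r x in auto)
  then show ?thesis using 0[OF x(2)] by simp
qed

text \<open>
  Disks are locally path connected, and this passes to relatively open subsets, in which connected
  points can therefore be joined by a path.
\<close>
lemma path_in_disk_complement:
  fixes D :: "'a::real_normed_vector set" and h :: "'b::real_normed_vector \<Rightarrow> 'a"
  assumes hom: "homeomorphism (cball (0::'b) 1) D h k" and A: "closed A"
    and conn: "connected_component (D - A) x y"
  obtains g where "path g" "path_image g \<subseteq> D - A" "pathstart g = x" "pathfinish g = y"
proof -
  have "locally path_connected (cball (0::'b) 1)"
    by (intro convex_imp_locally_path_connected) auto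
  moreover have "cball (0::'b) 1 homeomorphic D" using hom unfolding homeomorphic_def by auto
  ultimately have "locally path_connected D"
    using homeomorphic_locally[where P = path_connected and Q = path_connected,
        OF \<open>cball (0::'b) 1 homeomorphic D\<close> homeomorphic_path_connectedness] by simp
  moreover have "openin (top_of_set D) (D - A)"
    using A by (simp add: Diff_eq openin_open_Int open_Compl)
  ultimately have "locally path_connected (D - A)"
    by (rule locally_open_subset)
  then have "path_component (D - A) x y"
    using conn by (simp add: path_component_eq_connected_component)
  then show ?thesis using that by (auto simp: path_component_def)
qed

lemma linear_error_bound:
  fixes f :: "real \<Rightarrow> 'a::real_normed_vector"
  assumes "(f has_vector_derivative v) (at s)" "c > 0"
  obtains d where "d > 0" "\<And>x. \<bar>x - s\<bar> < d \<Longrightarrow> norm (f x - f s - (x - s) *\<^sub>R v) \<le> c * \<bar>x - s\<bar>"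
proof -
  have "\<exists>d>0. \<forall>x. norm (x - s) < d \<longrightarrow> norm (f x - f s - (x - s) *\<^sub>R v) \<le> c * norm (x - s)"
    using assms unfolding has_vector_derivative_def has_derivative_at_alt by simp
  then show ?thesis using that by auto
qed

text \<open>
  A path from the end of \<open>b\<close> back to its start that avoids \<open>a\<close> would complete \<open>b\<close> to a loop in the disk.
  Its winding number differs on the two sides of the crossing and is constant along the two remaining
  parts of \<open>a\<close>, yet it vanishes about both ends of \<open>a\<close>, which lie on the boundary circle.
\<close>
lemma orthogonal_arc_separates_plane_disk:
  fixes a b :: "real \<Rightarrow> complex"
  assumes hom: "homeomorphism (cball (0::complex) 1) D h k"
    and b: "continuous_on {b0..b1} b" "b ` {b0..b1} \<subseteq> D"
    and a: "continuous_on {a0..a1} a" "a ` {a0..a1} \<subseteq> D"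
    and ends: "a a0 \<in> h ` sphere 0 1" "a a1 \<in> h ` sphere 0 1"
    and s: "b0 < s" "s < b1" and t: "a0 < t" "t < a1"
    and meet: "b s = a t" "\<And>x y. x \<in> {b0..b1} \<Longrightarrow> y \<in> {a0..a1} \<Longrightarrow> b x = a y \<Longrightarrow> x = s \<and> y = t"
    and deriv: "(b has_vector_derivative 1) (at s)" "(a has_vector_derivative \<i>) (at t)"
  shows "\<not> connected_component (D - a ` {a0..a1}) (b b0) (b b1)"
proof
  assume conn: "connected_component (D - a ` {a0..a1}) (b b0) (b b1)"
  have "closed (a ` {a0..a1})"
    using a(1) by (intro compact_imp_closed compact_continuous_image) auto
  then obtain g where g: "path g" "path_image g \<subseteq> D - a ` {a0..a1}" "pathstart g = b b1" "pathfinish g = b b0"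
    using path_in_disk_complement[OF hom _ connected_component_sym[OF conn]] by metis
  obtain d1 where d1: "d1 > 0" "\<And>x. \<bar>x - s\<bar> < d1 \<Longrightarrow> norm (b x - b s - (x - s) *\<^sub>R 1) \<le> (1/8) * \<bar>x - s\<bar>"
    using linear_error_bound[OF deriv(1), of "1/8"] by auto
  obtain d2 where d2: "d2 > 0" "\<And>x. \<bar>x - t\<bar> < d2 \<Longrightarrow> norm (a x - a t - (x - t) *\<^sub>R \<i>) \<le> (1/8) * \<bar>x - t\<bar>"
    using linear_error_bound[OF deriv(2), of "1/8"] by auto
  define M where "M = Min {d1, d2, s - b0, b1 - s, t - a0, a1 - t}"
  have "M > 0"
    using d1(1) d2(1) s t by (auto simp: M_def)
  moreover have "M \<le> m" if "m \<in> {d1, d2, s - b0, b1 - s, t - a0, a1 - t}" for m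
    unfolding M_def using that by (intro Min_le) auto
  then have "M \<le> d1" "M \<le> d2" "M \<le> s - b0" "M \<le> b1 - s" "M \<le> t - a0" "M \<le> a1 - t"
    by simp_all
  moreover define e where "e = M / 2"
  ultimately have e: "e > 0" "e < d1" "e < d2" "e < s - b0" "e < b1 - s" "e < t - a0" "e < a1 - t"
    by linarith+
  define R where "R = subpath (s + e) b1 b +++ g +++ subpath b0 (s - e) b"
  define L where "L = subpath (s - e) (s + e) b +++ R"
  have bsub: "path (subpath u v b)" "path_image (subpath u v b) = b ` {u..v}" if "b0 \<le> u" "u \<le> v" "v \<le> b1" for u v
    using that b(1) by (auto simp: path_image_subpath intro!: path_subpath_continuous_on intro: continuous_on_subset)
  have R: "path R" "pathstart R = b (s + e)" "pathfinish R = b (s - e)"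
      "path_image R = b ` {s + e..b1} \<union> path_image g \<union> b ` {b0..s - e}"
    using bsub[of "s + e" b1] bsub[of b0 "s - e"] e g s unfolding R_def by (auto simp: path_image_join)
  have L: "path L" "pathfinish L = pathstart L" "path_image L = b ` {s - e..s + e} \<union> path_image R"
    using bsub[of "s - e" "s + e"] R e s unfolding L_def by (auto simp: path_image_join)
  have Ra: "path_image R \<inter> a ` {a0..a1} = {}"
  proof -
    have "b x \<noteq> a y" if "x \<in> {s + e..b1} \<union> {b0..s - e}" "y \<in> {a0..a1}" for x y
      using meet(2)[of x y] that e s by auto
    then have "b ` {s + e..b1} \<inter> a ` {a0..a1} = {}" "b ` {b0..s - e} \<inter> a ` {a0..a1} = {}"
      by blast+
    then show ?thesis unfolding R using g(2) by blast
  qed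
  have La: "path_image L \<inter> a ` (({a0..t - e} \<union> {t + e..a1})) = {}"
  proof -
    have "b x \<noteq> a y" if "x \<in> {s - e..s + e}" "y \<in> {a0..t - e} \<union> {t + e..a1}" for x y
      using meet(2)[of x y] that e s by auto
    then have "b ` {s - e..s + e} \<inter> a ` ({a0..t - e} \<union> {t + e..a1}) = {}"
      by blast
    moreover have "{a0..t - e} \<union> {t + e..a1} \<subseteq> {a0..a1}" using e t by auto
    then have "a ` ({a0..t - e} \<union> {t + e..a1}) \<subseteq> a ` {a0..a1}" by (rule image_mono)
    ultimately show ?thesis unfolding L(3) using Ra by blast
  qed
  have "b ` {s - e..s + e} \<subseteq> b ` {b0..b1}" "b ` {s + e..b1} \<subseteq> b ` {b0..b1}" "b ` {b0..s - e} \<subseteq> b ` {b0..b1}"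
    using e s by (intro image_mono; auto)+
  then have LD: "path_image L \<subseteq> D"
    unfolding L(3) R(4) using b(2) g(2) by blast
  have "winding_number L (a (t + e)) \<noteq> winding_number L (a (t - e))"
    unfolding L_def
  proof (rule winding_number_changes_at_crossing[where p = "b s"])
    show "cmod (b x - b s - complex_of_real (x - s)) \<le> \<bar>x - s\<bar> / 8" if "\<bar>x - s\<bar> \<le> e" for x
      using d1(2)[of x] that e by (simp add: scaleR_conv_of_real)
    show "cmod (a x - b s - \<i> * complex_of_real (x - t)) \<le> \<bar>x - t\<bar> / 8" if "\<bar>x - t\<bar> \<le> e" for x
      using d2(2)[of x] that e by (simp add: scaleR_conv_of_real meet(1) mult.commute)
    have "a ` {t - e..t + e} \<subseteq> a ` {a0..a1}" using e by (intro image_mono) auto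
    then show "path_image R \<inter> a ` {t - e..t + e} = {}" using Ra by blast
  qed (use e R in \<open>auto intro: continuous_on_subset[OF b(1)] continuous_on_subset[OF a(1)]\<close>)
  moreover have "winding_number L (a (t + e)) = winding_number L (a a1)"
    by (rule winding_number_eq[where S = "a ` {t + e..a1}"])
      (use L La e t in \<open>auto intro!: connected_continuous_image continuous_on_subset[OF a(1)]\<close>)
  moreover have "winding_number L (a (t - e)) = winding_number L (a a0)"
    by (rule winding_number_eq[where S = "a ` {a0..t - e}"])
      (use L La e t in \<open>auto intro!: connected_continuous_image continuous_on_subset[OF a(1)]\<close>)
  moreover have "a a0 \<notin> path_image L" "a a1 \<notin> path_image L"
    using La e t by fastforce+
  then have "winding_number L (a a0) = 0" "winding_number L (a a1) = 0"
    using winding_number_disk_boundary[OF hom _ L(1,2) LD] ends by blast+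
  ultimately show False by simp
qed

text \<open>
  The chart is stereographic projection from \<open>q\<close>, after a rotation that moves \<open>q\<close> to the third axis.
  The differentiable left inverse makes the chart injective on points, and its derivative on velocities.
\<close>
lemma stereographic_chart:
  assumes "q \<in> S2"
  obtains \<Phi> :: "real^3 \<Rightarrow> complex" and \<Psi>
    where "\<And>x. x \<in> S2 - {q} \<Longrightarrow> \<Phi> differentiable (at x)"
      and "\<And>x. x \<in> S2 - {q} \<Longrightarrow> \<Psi> (\<Phi> x) = x"
      and "\<And>z. \<Psi> differentiable (at z)"
proof -
  have unit_vectors: "norm q = 1" "norm (axis 3 1 :: real^3) = 1" using assms by auto
  obtain f :: "real^3 \<Rightarrow> real^3" where f: "orthogonal_transformation f" "f q = axis 3 1"
    by (rule orthogonal_transformation_exists_1[OF unit_vectors])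
  define g where "g = inv f"
  have g: "orthogonal_transformation g" "\<And>x. g (f x) = x"
    using orthogonal_transformation_inv[OF f(1)] orthogonal_transformation_inj[OF f(1)]
    by (simp_all add: g_def)
  have lin: "bounded_linear f" "bounded_linear g"
    using f(1) g(1) by (auto simp: orthogonal_transformation_def linear_conv_bounded_linear)
  define \<Phi> where "\<Phi> x = (f x $ 1 / (1 - f x $ 3)) *\<^sub>R 1 + (f x $ 2 / (1 - f x $ 3)) *\<^sub>R \<i>" for x
  define \<psi> where "\<psi> z = (1 / ((Re z)\<^sup>2 + (Im z)\<^sup>2 + 1)) *\<^sub>R ((2 * Re z) *\<^sub>R axis 1 1 + (2 * Im z) *\<^sub>R axis 2 1
      + ((Re z)\<^sup>2 + (Im z)\<^sup>2 - 1) *\<^sub>R (axis 3 1 :: real^3))" for z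
  have unit: "(f x $ 1)\<^sup>2 + (f x $ 2)\<^sup>2 + (f x $ 3)\<^sup>2 = 1" if "x \<in> S2" for x
  proof -
    have "norm (f x) = 1" using that orthogonal_transformation_norm[OF f(1)] by simp
    then show ?thesis by (simp only: norm_eq_1 inner_vec_def sum_3 inner_real_def power2_eq_square)
  qed
  have ne: "f x $ 3 \<noteq> 1" if "x \<in> S2 - {q}" for x
  proof
    assume "f x $ 3 = 1"
    moreover from this have "(f x $ 1)\<^sup>2 + (f x $ 2)\<^sup>2 = 0" using unit[of x] that by simp
    then have "f x $ 1 = 0" "f x $ 2 = 0" by (simp_all add: sum_power2_eq_zero_iff)
    ultimately have "f x = f q" by (simp add: f(2) vec_eq_iff forall_3 axis_def)
    then have "x = q" using g(2) by metis
    then show False using that by simp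
  qed
  show ?thesis
  proof
    fix x :: "real^3" assume x: "x \<in> S2 - {q}"
    have fd: "(\<lambda>y. f y $ i) differentiable (at x)" for i
      using bounded_linear_compose[OF bounded_linear_vec_nth lin(1), of i]
      by (simp add: bounded_linear_imp_differentiable)
    show "\<Phi> differentiable (at x)"
      unfolding \<Phi>_def using ne[OF x] by (simp add: fd)
    define X Y Z where "X = f x $ 1" and "Y = f x $ 2" and "Z = f x $ 3"
    have Z: "Z \<noteq> 1" "X\<^sup>2 + Y\<^sup>2 = (1 - Z) * (1 + Z)"
      using ne[OF x] unit[of x] x unfolding X_def Y_def Z_def by (simp, simp add: power2_eq_square algebra_simps)
    have \<Phi>: "Re (\<Phi> x) = X / (1 - Z)" "Im (\<Phi> x) = Y / (1 - Z)"
      by (auto simp: \<Phi>_def X_def Y_def Z_def)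
    have N: "(Re (\<Phi> x))\<^sup>2 + (Im (\<Phi> x))\<^sup>2 = (1 + Z) / (1 - Z)"
    proof -
      have "(Re (\<Phi> x))\<^sup>2 + (Im (\<Phi> x))\<^sup>2 = (X\<^sup>2 + Y\<^sup>2) / (1 - Z)\<^sup>2"
        by (simp add: \<Phi> power_divide add_divide_distrib)
      also have "\<dots> = (1 + Z) / (1 - Z)"
        using Z by (simp add: power2_eq_square)
      finally show ?thesis .
    qed
    have N1: "(1 + Z) / (1 - Z) + 1 = 2 / (1 - Z)" "(1 + Z) / (1 - Z) - 1 = 2 * Z / (1 - Z)"
      using Z(1) by (auto simp: divide_simps)
    have "\<psi> (\<Phi> x) = f x"
      unfolding \<psi>_def N N1 unfolding \<Phi> using Z(1)
      by (simp add: vec_eq_iff forall_3 axis_def X_def Y_def Z_def)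
    then show "(g \<circ> \<psi>) (\<Phi> x) = x" by (simp add: g(2))
  next
    fix z :: complex
    have pos: "(Re z)\<^sup>2 + (Im z)\<^sup>2 + 1 \<noteq> 0"
      using sum_power2_ge_zero[of "Re z" "Im z"] by linarith
    have "Re differentiable (at z)" "Im differentiable (at z)"
      by (simp_all add: bounded_linear_imp_differentiable bounded_linear_Re bounded_linear_Im)
    then have "\<psi> differentiable (at z)"
      unfolding \<psi>_def using pos by simp
    then show "(g \<circ> \<psi>) differentiable (at z)"
      using differentiable_chain_at[of \<psi> z g] bounded_linear_imp_differentiable[OF lin(2)] by blast
  qed
qed

lemma real_parallel_complex:
  assumes "v \<noteq> 0" "Im (v * cnj w) = 0"
  obtains c where "w = c *\<^sub>R v"
proof
  have "Im (w * cnj v) = 0" using assms(2) by (simp add: mult.commute)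
  then have "w * cnj v = of_real (Re (w * cnj v))" by (simp add: complex_eq_iff)
  then have "w * (cnj v * v) = of_real (Re (w * cnj v)) * v" by (metis mult.assoc)
  moreover have "cnj v * v = of_real ((cmod v)\<^sup>2)" by (metis complex_norm_square mult.commute)
  ultimately have "w * of_real ((cmod v)\<^sup>2) = of_real (Re (w * cnj v)) * v" by simp
  then show "w = (Re (w * cnj v) / (cmod v)\<^sup>2) *\<^sub>R v"
    using assms(1) by (simp add: scaleR_conv_of_real nonzero_eq_divide_eq)
qed

text \<open>
  The coordinates of \<open>z\<close> with respect to the basis \<open>v\<close>, \<open>w\<close> are given by Cramer's rule, the
  determinant of two complex numbers being \<open>Im (v * cnj w)\<close>, up to sign.
\<close>
lemma linear_independent_to_orthogonal:
  assumes "Im (v * cnj w) \<noteq> 0"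
  obtains T :: "complex \<Rightarrow> complex" where "bounded_linear T" "inj T" "T v = 1" "T w = \<i>"
proof -
  define d where "d = Im (v * cnj w)"
  define T where "T z = of_real (Im (z * cnj w) / d) + \<i> * of_real (Im (v * cnj z) / d)" for z
  have "linear T"
    by (rule linearI) (auto simp: T_def complex_eq_iff algebra_simps add_divide_distrib diff_divide_distrib)
  then have 1: "bounded_linear T" by (simp add: linear_conv_bounded_linear)
  have "z = 0" if "T z = 0" for z
  proof -
    have *: "Im z * Re w - Re z * Im w = 0" "Im v * Re z - Re v * Im z = 0"
      using that assms by (auto simp: T_def complex_eq_iff d_def)
    have "Im z * d = 0" "Re z * d = 0" unfolding d_def using * by (simp; algebra)+
    then show ?thesis using assms by (simp add: d_def complex_eq_iff)
  qed
  then have 2: "inj T" using \<open>linear T\<close> by (simp add: linear_injective_0)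
  have 3: "T v = 1" "T w = \<i>"
    using assms by (auto simp: T_def complex_eq_iff d_def)
  show ?thesis using that[OF 1 2 3] .
qed

lemma has_vector_derivative_compose_differentiable:
  assumes "(f has_vector_derivative v) (at t)" "g differentiable (at (f t))"
  shows "((\<lambda>x. g (f x)) has_vector_derivative frechet_derivative g (at (f t)) v) (at t)"
proof -
  have "(g has_derivative frechet_derivative g (at (f t))) (at (f t) within range f)"
    using assms(2) by (simp add: frechet_derivative_works has_derivative_at_withinI)
  then show ?thesis
    using vector_derivative_diff_chain_within[of f v t UNIV g] assms(1) by (simp add: o_def)
qed

text \<open>
  A disk is contractible, the sphere is not.
\<close>
lemma disk_proper_subset_sphere:
  assumes "disk_with_boundary D B"
  obtains q where "q \<in> S2" "q \<notin> D"
proof -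
  obtain h k where D: "D \<subseteq> S2" "homeomorphism (cball (0::complex) 1) D h k"
    using assms by (auto simp: disk_with_boundary_def)
  have "contractible (cball (0::complex) 1)" by (intro convex_imp_contractible convex_cball)
  moreover have "cball (0::complex) 1 homeomorphic D" using D(2) by (auto simp: homeomorphic_def)
  ultimately have "contractible D" by (rule homeomorphic_contractible)
  then have "D \<noteq> S2" using contractible_sphere[of "0 :: real^3" 1] by auto
  then show ?thesis using D(1) that by blast
qed

text \<open>
  Stereographic projection from a point off the disk, followed by a linear map that makes the two
  velocities at the crossing equal to \<open>1\<close> and \<open>\<i>\<close>, reduces the claim to the plane.
\<close>
lemma transverse_arc_separates_disk:
  fixes a b :: "real \<Rightarrow> real^3"
  assumes disk: "disk_with_boundary D B"
    and b: "continuous_on {b0..b1} b" "b ` {b0..b1} \<subseteq> D"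
    and a: "continuous_on {a0..a1} a" "a ` {a0..a1} \<subseteq> D"
    and ends: "a a0 \<in> B" "a a1 \<in> B"
    and s: "b0 < s" "s < b1" and t: "a0 < t" "t < a1"
    and meet: "b s = a t" "\<And>x y. x \<in> {b0..b1} \<Longrightarrow> y \<in> {a0..a1} \<Longrightarrow> b x = a y \<Longrightarrow> x = s \<and> y = t"
    and deriv: "(b has_vector_derivative v) (at s)" "(a has_vector_derivative w) (at t)"
    and transverse: "\<not> collinear {0, v, w}"
  shows "\<not> connected_component (D - a ` {a0..a1}) (b b0) (b b1)"
proof
  assume conn: "connected_component (D - a ` {a0..a1}) (b b0) (b b1)"
  obtain h k where D: "D \<subseteq> S2" "homeomorphism (cball (0::complex) 1) D h k" "B = h ` sphere 0 1"
    using disk by (auto simp: disk_with_boundary_def)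
  obtain q where q: "q \<in> S2" "q \<notin> D" using disk_proper_subset_sphere[OF disk] by metis
  have Dq: "x \<in> S2 - {q}" if "x \<in> D" for x using that D(1) q by auto
  obtain \<Phi> :: "real^3 \<Rightarrow> complex" and \<Psi> where \<Phi>: "\<And>x. x \<in> S2 - {q} \<Longrightarrow> \<Phi> differentiable (at x)"
      "\<And>x. x \<in> S2 - {q} \<Longrightarrow> \<Psi> (\<Phi> x) = x" "\<And>z. \<Psi> differentiable (at z)"
    using stereographic_chart[OF q(1)] by metis
  define v' where "v' = frechet_derivative \<Phi> (at (b s)) v"
  define w' where "w' = frechet_derivative \<Phi> (at (a t)) w"
  define L where "L = frechet_derivative \<Psi> (at (\<Phi> (b s)))"
  have inD: "b s \<in> D" "a t \<in> D" using b(2) a(2) s t by (auto simp: image_subset_iff)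
  have dv: "((\<lambda>x. \<Phi> (b x)) has_vector_derivative v') (at s)"
    unfolding v'_def using \<Phi>(1)[OF Dq[OF inD(1)]] by (rule has_vector_derivative_compose_differentiable[OF deriv(1)])
  have dw: "((\<lambda>x. \<Phi> (a x)) has_vector_derivative w') (at t)"
    unfolding w'_def using \<Phi>(1)[OF Dq[OF inD(2)]] by (rule has_vector_derivative_compose_differentiable[OF deriv(2)])
  \<comment> \<open>The derivative of the inverse chart recovers the velocities on the sphere.\<close>
  have Lv: "L v' = v"
  proof -
    have "((\<lambda>x. \<Psi> (\<Phi> (b x))) has_vector_derivative L v') (at s)"
      unfolding L_def using has_vector_derivative_compose_differentiable[OF dv \<Phi>(3)] .
    moreover have "\<Psi> (\<Phi> (b x)) = b x" if "x \<in> {b0<..<b1}" for x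
      using \<Phi>(2)[OF Dq, of "b x"] b(2) that by (auto simp: image_subset_iff)
    ultimately have "(b has_vector_derivative L v') (at s)"
      using s by (intro has_vector_derivative_transform_within_open[where S = "{b0<..<b1}" and f = "\<lambda>x. \<Psi> (\<Phi> (b x))" and g = b]) auto
    then show ?thesis using deriv(1) vector_derivative_unique_at by blast
  qed
  have Lw: "L w' = w"
  proof -
    have "((\<lambda>x. \<Psi> (\<Phi> (a x))) has_vector_derivative L w') (at t)"
      unfolding L_def meet(1) using has_vector_derivative_compose_differentiable[OF dw \<Phi>(3)] .
    moreover have "\<Psi> (\<Phi> (a x)) = a x" if "x \<in> {a0<..<a1}" for x
      using \<Phi>(2)[OF Dq, of "a x"] a(2) that by (auto simp: image_subset_iff)
    ultimately have "(a has_vector_derivative L w') (at t)"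
      using t by (intro has_vector_derivative_transform_within_open[where S = "{a0<..<a1}" and f = "\<lambda>x. \<Psi> (\<Phi> (a x))" and g = a]) auto
    then show ?thesis using deriv(2) vector_derivative_unique_at by blast
  qed
  have lin: "linear L"
    unfolding L_def using \<Phi>(3) by (simp add: linear_frechet_derivative)
  have "Im (v' * cnj w') \<noteq> 0"
  proof
    assume 0: "Im (v' * cnj w') = 0"
    have "v' \<noteq> 0" using Lv lin transverse by (auto simp: linear_0 insert_absorb)
    then obtain c where "w' = c *\<^sub>R v'" using real_parallel_complex 0 by blast
    then have "w = c *\<^sub>R v" using Lv Lw lin by (metis linear_cmul)
    then show False using transverse by (simp add: collinear_lemma)
  qed
  then obtain T where T: "bounded_linear T" "inj T" "T v' = 1" "T w' = \<i>"
    by (rule linear_independent_to_orthogonal)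
  define F where "F = (\<lambda>x. T (\<Phi> x))"
  have Fcont: "continuous_on D F"
  proof -
    have "continuous_on D \<Phi>"
      by (intro continuous_at_imp_continuous_on ballI differentiable_imp_continuous_within \<Phi>(1) Dq)
    then show ?thesis unfolding F_def by (rule bounded_linear.continuous_on[OF T(1)])
  qed
  have Finj: "inj_on F D"
  proof (rule inj_onI)
    fix x y assume "x \<in> D" "y \<in> D" "F x = F y"
    then have "\<Phi> x = \<Phi> y" using T(2) by (auto simp: F_def inj_def)
    then show "x = y" using \<Phi>(2)[OF Dq[OF \<open>x \<in> D\<close>]] \<Phi>(2)[OF Dq[OF \<open>y \<in> D\<close>]] by metis
  qed
  have h: "continuous_on (cball 0 1) h" "h ` cball 0 1 = D" "inj_on h (cball 0 1)"
    using D(2) by (auto simp: homeomorphism_def intro: inj_on_inverseI)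
  have "\<exists>k'. homeomorphism (cball (0::complex) 1) (F ` D) (F \<circ> h) k'"
  proof (rule homeomorphism_compact[of "cball (0::complex) 1" "F \<circ> h" "F ` D"])
    show "continuous_on (cball 0 1) (F \<circ> h)"
      using h Fcont by (intro continuous_on_compose) auto
    show "(F \<circ> h) ` cball 0 1 = F ` D" unfolding image_comp[symmetric] h(2) ..
    show "inj_on (F \<circ> h) (cball 0 1)"
      using h Finj by (intro comp_inj_on) auto
  qed auto
  then obtain k' where hom: "homeomorphism (cball (0::complex) 1) (F ` D) (F \<circ> h) k'" ..
  have "\<not> connected_component (F ` D - (\<lambda>x. F (a x)) ` {a0..a1}) (F (b b0)) (F (b b1))"
  proof (rule orthogonal_arc_separates_plane_disk[OF hom, where s = s and t = t])
    show "continuous_on {b0..b1} (\<lambda>x. F (b x))" "continuous_on {a0..a1} (\<lambda>x. F (a x))"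
      using a b by (auto intro: continuous_on_compose2[OF Fcont])
    show "(\<lambda>x. F (b x)) ` {b0..b1} \<subseteq> F ` D" "(\<lambda>x. F (a x)) ` {a0..a1} \<subseteq> F ` D"
      using a b by auto
    show "F (a a0) \<in> (F \<circ> h) ` sphere 0 1" "F (a a1) \<in> (F \<circ> h) ` sphere 0 1"
      using ends unfolding D(3) by auto
    show "((\<lambda>x. F (b x)) has_vector_derivative 1) (at s)"
      using bounded_linear.has_vector_derivative[OF T(1) dv] by (simp add: F_def T)
    show "((\<lambda>x. F (a x)) has_vector_derivative \<i>) (at t)"
      using bounded_linear.has_vector_derivative[OF T(1) dw] by (simp add: F_def T)
    show "x = s \<and> y = t" if "x \<in> {b0..b1}" "y \<in> {a0..a1}" "F (b x) = F (a y)" for x y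
    proof -
      have "b x \<in> D" "a y \<in> D" using that a(2) b(2) by auto
      then have "b x = a y" using that(3) Finj by (simp add: inj_on_eq_iff)
      then show ?thesis using meet(2) that by blast
    qed
  qed (use s t meet in auto)
  moreover have "connected_component (F ` D - (\<lambda>x. F (a x)) ` {a0..a1}) (F (b b0)) (F (b b1))"
  proof -
    obtain C where C: "connected C" "C \<subseteq> D - a ` {a0..a1}" "b b0 \<in> C" "b b1 \<in> C"
      using conn by (auto simp: connected_component_def)
    have "connected (F ` C)"
      using C by (intro connected_continuous_image continuous_on_subset[OF Fcont]) auto
    moreover have "F ` C \<subseteq> F ` D - (\<lambda>x. F (a x)) ` {a0..a1}"
    proof -
      have "F x \<noteq> F (a y)" if "x \<in> C" "y \<in> {a0..a1}" for x y
      proof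
        assume "F x = F (a y)"
        moreover have "x \<in> D" "a y \<in> D" using that C(2) a(2) by auto
        ultimately have "x = a y" using Finj by (simp add: inj_on_eq_iff)
        then show False using that C(2) by auto
      qed
      then show ?thesis using C(2) by auto
    qed
    ultimately show ?thesis
      using C(3,4) unfolding connected_component_def by blast
  qed
  ultimately show False by simp
qed

section \<open>Transverse closed curves\<close>

lemma periodic_eq_frac:
  fixes f :: "real \<Rightarrow> 'a"
  assumes "\<And>t. f (t + 1) = f t"
  shows "f t = f (frac t)"
proof -
  have "f (x + of_int n) = f x" for n :: int and x
  proof (induction n rule: int_induct[where k = 0])
    case (step1 i)
    then show ?case using assms[of "x + of_int i"] by (simp add: add.assoc)
  next
    case (step2 i)
    then show ?case using assms[of "x + of_int (i - 1)"] by (simp add: add.assoc)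
  qed simp
  from this[of "frac t" "\<lfloor>t\<rfloor>"] show ?thesis by (simp add: frac_def)
qed

lemma frac_in_unit: "frac (t::real) \<in> {0..<1}"
  by (simp add: frac_lt_1)

lemma range_periodic:
  fixes f :: "real \<Rightarrow> 'a"
  assumes "\<And>t. f (t + 1) = f t"
  shows "range f = f ` {0..<1}"
proof -
  have "f x \<in> f ` {0..<1}" for x
    unfolding periodic_eq_frac[of f x, OF assms] using frac_in_unit by (rule imageI)
  then show ?thesis by blast
qed

text \<open>
  The vectors \<open>(q \<bullet> q) v - (v \<bullet> q) q\<close>, with \<open>v = c q\<close>, vanish; so does their limit, which expresses
  the limit of \<open>c q\<close> as a multiple of \<open>w\<close>.
\<close>
lemma parallel_limit:
  fixes v w :: "'a::real_inner"
  assumes "(\<lambda>n. c n *\<^sub>R q n) \<longlonglongrightarrow> v" "q \<longlonglongrightarrow> w" "w \<noteq> 0"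
  obtains r where "v = r *\<^sub>R w"
proof
  have "(\<lambda>n. (q n \<bullet> q n) *\<^sub>R (c n *\<^sub>R q n) - ((c n *\<^sub>R q n) \<bullet> q n) *\<^sub>R q n) \<longlonglongrightarrow> (w \<bullet> w) *\<^sub>R v - (v \<bullet> w) *\<^sub>R w"
    by (intro tendsto_intros assms)
  then have "(\<lambda>n. 0) \<longlonglongrightarrow> (w \<bullet> w) *\<^sub>R v - (v \<bullet> w) *\<^sub>R w"
    by (simp add: mult.commute)
  then have "(w \<bullet> w) *\<^sub>R v = (v \<bullet> w) *\<^sub>R w"
    using LIMSEQ_unique[OF tendsto_const] by fastforce
  then have "(1 / (w \<bullet> w)) *\<^sub>R (w \<bullet> w) *\<^sub>R v = (1 / (w \<bullet> w)) *\<^sub>R (v \<bullet> w) *\<^sub>R w" by simp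
  then show "v = ((v \<bullet> w) / (w \<bullet> w)) *\<^sub>R w" using assms(3) by simp
qed

text \<open>
  \<open>Q y\<close> is the slope of the secant from \<open>t\<close> to \<open>y\<close>, and the derivative at \<open>y = t\<close>; with this convention
  sequences that hit \<open>t\<close> need no separate treatment.
\<close>
lemma secant_slope:
  fixes f :: "real \<Rightarrow> 'a::real_normed_vector"
  assumes "(f has_vector_derivative v) (at t)"
  obtains Q where "\<And>y. f y - f t = (y - t) *\<^sub>R Q y"
    "\<And>x. x \<longlonglongrightarrow> t \<Longrightarrow> (\<lambda>n. Q (x n)) \<longlonglongrightarrow> v"
proof
  define Q where "Q y = (if y = t then v else (1 / (y - t)) *\<^sub>R (f y - f t))" for y
  show eq: "f y - f t = (y - t) *\<^sub>R Q y" for y by (simp add: Q_def)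
  show "(\<lambda>n. Q (x n)) \<longlonglongrightarrow> v" if x: "x \<longlonglongrightarrow> t" for x :: "nat \<Rightarrow> real"
  proof (rule metric_LIMSEQ_I)
    fix e :: real assume "e > 0"
    obtain d where d: "d > 0" "\<And>y. \<bar>y - t\<bar> < d \<Longrightarrow> norm (f y - f t - (y - t) *\<^sub>R v) \<le> e / 2 * \<bar>y - t\<bar>"
      using linear_error_bound[OF assms, of "e / 2"] \<open>e > 0\<close> by auto
    have close: "norm (Q y - v) < e" if "\<bar>y - t\<bar> < d" for y
    proof (cases "y = t")
      case False
      have "f y - f t - (y - t) *\<^sub>R v = (y - t) *\<^sub>R (Q y - v)"
        unfolding eq by (simp add: algebra_simps)
      then have "\<bar>y - t\<bar> * norm (Q y - v) \<le> \<bar>y - t\<bar> * (e / 2)"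
        using d(2)[OF that] by (simp add: mult.commute)
      then have "norm (Q y - v) \<le> e / 2" using False by (simp add: mult_le_cancel_left)
      then show ?thesis using \<open>e > 0\<close> by simp
    qed (use \<open>e > 0\<close> in \<open>simp add: Q_def\<close>)
    obtain N where "\<And>n. n \<ge> N \<Longrightarrow> dist (x n) t < d" using metric_LIMSEQ_D[OF x d(1)] by blast
    then show "\<exists>N. \<forall>n\<ge>N. dist (Q (x n)) v < e" using close by (auto simp: dist_norm)
  qed
qed

text \<open>
  This class contains the generic immersions and their images under the end map of an ambient isotopy.
\<close>
locale transverse_closed_curve =
  fixes \<gamma> \<gamma>' :: "real \<Rightarrow> real^3"
  assumes deriv: "(\<gamma> has_vector_derivative \<gamma>' t) (at t)"
    and deriv_continuous: "continuous_on UNIV \<gamma>'"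
    and periodic: "\<gamma> (t + 1) = \<gamma> t"
    and immersed: "\<gamma>' t \<noteq> 0"
    and transverse: "s \<in> {0..<1} \<Longrightarrow> t \<in> {0..<1} \<Longrightarrow> s \<noteq> t \<Longrightarrow> \<gamma> s = \<gamma> t \<Longrightarrow>
      \<not> collinear {0, \<gamma>' s, \<gamma>' t}"
begin

lemma continuous: "continuous_on S \<gamma>"
  using deriv by (meson continuous_at_imp_continuous_on has_vector_derivative_continuous)

lemma tendsto: "x \<longlonglongrightarrow> t \<Longrightarrow> (\<lambda>n. \<gamma> (x n)) \<longlonglongrightarrow> \<gamma> t"
  using continuous_on_tendsto_compose[OF continuous[of UNIV], of x t sequentially] by simp

lemma deriv_periodic: "\<gamma>' (t + 1) = \<gamma>' t"
proof -
  have "((\<lambda>x. x + 1) has_vector_derivative 1) (at t)"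
    by (simp add: has_vector_derivative_add_const)
  then have "((\<lambda>x. \<gamma> (x + 1)) has_vector_derivative \<gamma>' (t + 1)) (at t)"
    using vector_diff_chain_at[of "\<lambda>x. x + 1" 1 t \<gamma> "\<gamma>' (t + 1)"] deriv[of "t + 1"]
    by (simp add: o_def)
  then have "(\<gamma> has_vector_derivative \<gamma>' (t + 1)) (at t)" by (simp add: periodic)
  then show ?thesis using deriv vector_derivative_unique_at by blast
qed

lemma not_parallel:
  assumes "s \<in> {0..<1}" "t \<in> {0..<1}" "s \<noteq> t" "\<gamma> s = \<gamma> t"
  shows "\<gamma>' s \<noteq> c *\<^sub>R \<gamma>' t"
  using transverse[OF assms(2,1) assms(3)[symmetric] assms(4)[symmetric]] by (auto simp: collinear_lemma)

lemma range_eq: "range \<gamma> = \<gamma> ` {0..<1}"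
  using periodic by (rule range_periodic)

end

text \<open>
  The velocity \<open>\<gamma>' t\<close> is the limit of secant slopes from \<open>\<gamma> t\<close> to nearby points of the image. These points
  are also points \<open>\<delta> (s n)\<close>; along a convergent subsequence of the times \<open>s n\<close> the same secants have
  directions that tend to the tangent direction of \<open>\<delta>\<close> at the limit.
\<close>
lemma tangent_transfer:
  assumes "transverse_closed_curve \<gamma> \<gamma>'" "transverse_closed_curve \<delta> \<delta>'" "range \<gamma> \<subseteq> range \<delta>"
  obtains s c where "s \<in> {0..<1}" "\<delta> s = \<gamma> t" "\<gamma>' t = c *\<^sub>R \<delta>' s"
proof -
  interpret g: transverse_closed_curve \<gamma> \<gamma>' by fact
  interpret d: transverse_closed_curve \<delta> \<delta>' by fact
  define h where "h n = 1 / real (Suc n)" for n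
  have h: "h \<longlonglongrightarrow> 0" "h n \<noteq> 0" for n
    unfolding h_def using LIMSEQ_inverse_real_of_nat by (simp_all add: inverse_eq_divide)
  have "\<exists>s\<in>{0..1}. \<delta> s = \<gamma> (t + h n)" for n
  proof -
    have "\<gamma> (t + h n) \<in> \<delta> ` {0..<1}" using assms(3) unfolding d.range_eq by blast
    then obtain s where "s \<in> {0..<1}" "\<gamma> (t + h n) = \<delta> s" by blast
    then show ?thesis by (intro bexI[of _ s]) auto
  qed
  then obtain s where s: "\<And>n. s n \<in> {0..1}" "\<And>n. \<delta> (s n) = \<gamma> (t + h n)" by metis
  obtain s0 r where r: "s0 \<in> {0..1}" "strict_mono r" "(s \<circ> r) \<longlonglongrightarrow> s0"
    using compact_Icc[of "0::real" 1] s(1) unfolding compact_def by meson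
  have hr: "(\<lambda>n. h (r n)) \<longlonglongrightarrow> 0" using LIMSEQ_subseq_LIMSEQ[OF h(1) r(2)] by (simp add: o_def)
  then have tr: "(\<lambda>n. t + h (r n)) \<longlonglongrightarrow> t" using tendsto_add[OF tendsto_const hr, of t] by simp
  have sr: "(\<lambda>n. s (r n)) \<longlonglongrightarrow> s0" using r(3) by (simp add: o_def)
  have eq: "\<delta> s0 = \<gamma> t"
    using d.tendsto[OF sr] g.tendsto[OF tr] s(2) LIMSEQ_unique by simp
  obtain Q where Q: "\<And>y. \<gamma> y - \<gamma> t = (y - t) *\<^sub>R Q y" "\<And>x. x \<longlonglongrightarrow> t \<Longrightarrow> (\<lambda>n. Q (x n)) \<longlonglongrightarrow> \<gamma>' t"
    using secant_slope[OF g.deriv[of t]] by metis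
  obtain R where R: "\<And>y. \<delta> y - \<delta> s0 = (y - s0) *\<^sub>R R y" "\<And>x. x \<longlonglongrightarrow> s0 \<Longrightarrow> (\<lambda>n. R (x n)) \<longlonglongrightarrow> \<delta>' s0"
    using secant_slope[OF d.deriv[of s0]] by metis
  have "Q (t + h (r n)) = ((s (r n) - s0) / h (r n)) *\<^sub>R R (s (r n))" for n
  proof -
    have "h (r n) *\<^sub>R Q (t + h (r n)) = (s (r n) - s0) *\<^sub>R R (s (r n))"
      using Q(1)[of "t + h (r n)"] R(1)[of "s (r n)"] s(2)[of "r n"] eq by simp
    then have "(1 / h (r n)) *\<^sub>R h (r n) *\<^sub>R Q (t + h (r n)) = (1 / h (r n)) *\<^sub>R (s (r n) - s0) *\<^sub>R R (s (r n))"
      by simp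
    then show ?thesis using h(2) by simp
  qed
  then have "(\<lambda>n. ((s (r n) - s0) / h (r n)) *\<^sub>R R (s (r n))) \<longlonglongrightarrow> \<gamma>' t"
    using Q(2)[OF tr] by simp
  then obtain c where c: "\<gamma>' t = c *\<^sub>R \<delta>' s0"
    by (rule parallel_limit[OF _ R(2)[OF sr] d.immersed])
  show thesis
  proof (rule that[of "frac s0"])
    show "\<delta> (frac s0) = \<gamma> t" "\<gamma>' t = c *\<^sub>R \<delta>' (frac s0)"
      using eq c periodic_eq_frac[of \<delta> s0, OF d.periodic] periodic_eq_frac[of \<delta>' s0, OF d.deriv_periodic]
      by simp_all
  qed (rule frac_in_unit)
qed

context transverse_closed_curve
begin

definition endpoints :: "real set" where
  "endpoints = {s \<in> {0..<1}. \<exists>t\<in>{0..<1}. t \<noteq> s \<and> \<gamma> s = \<gamma> t}"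

text \<open>
  Near \<open>t\<close> the component of \<open>\<gamma>\<close> in the direction \<open>\<gamma>' t\<close> is strictly increasing.
\<close>
lemma locally_injective: "\<exists>e>0. inj_on \<gamma> {t - e<..<t + e}"
proof -
  have "open ((\<lambda>x. \<gamma>' x \<bullet> \<gamma>' t) -` {0<..})"
    by (intro open_vimage continuous_intros deriv_continuous)
  moreover have "t \<in> (\<lambda>x. \<gamma>' x \<bullet> \<gamma>' t) -` {0<..}" using immersed[of t] by simp
  ultimately obtain e where e: "e > 0" "ball t e \<subseteq> (\<lambda>x. \<gamma>' x \<bullet> \<gamma>' t) -` {0<..}"
    unfolding open_contains_ball by blast
  have less: "\<gamma> x \<bullet> \<gamma>' t < \<gamma> y \<bullet> \<gamma>' t" if "x < y" "x \<in> {t - e<..<t + e}" "y \<in> {t - e<..<t + e}" for x y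
  proof (rule DERIV_pos_imp_increasing[OF that(1)])
    fix z assume z: "x \<le> z" "z \<le> y"
    have "z \<in> ball t e" using z that(2,3) by (simp add: dist_real_def abs_less_iff)
    then have "\<gamma>' z \<bullet> \<gamma>' t > 0" using subsetD[OF e(2)] by simp
    moreover have "((\<lambda>x. \<gamma> x \<bullet> \<gamma>' t) has_vector_derivative \<gamma>' z \<bullet> \<gamma>' t) (at z)"
      using bounded_linear.has_vector_derivative[OF bounded_linear_inner_left deriv] .
    ultimately show "\<exists>d. ((\<lambda>x. \<gamma> x \<bullet> \<gamma>' t) has_real_derivative d) (at z) \<and> 0 < d"
      by (auto simp: has_real_derivative_iff_has_vector_derivative)
  qed
  have "inj_on \<gamma> {t - e<..<t + e}"
    by (rule linorder_inj_onI) (use less in \<open>force+\<close>)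
  then show ?thesis using e(1) by blast
qed

text \<open>
  Otherwise two sequences of times with equal images accumulate at times \<open>s0\<close> and \<open>t0\<close>. Comparing
  secants shows that the velocities at \<open>s0\<close> and \<open>t0\<close> are parallel, so by transversality both are the same
  point of the circle; but there the curve is locally injective.
\<close>
lemma finite_endpoints: "finite endpoints"
proof (rule ccontr)
  assume "infinite endpoints"
  moreover have "endpoints \<subseteq> {0..1}" by (auto simp: endpoints_def)
  ultimately obtain s0 where s0: "s0 \<in> {0..1}" "s0 islimpt endpoints"
    using compact_Icc[of "0::real" 1] compact_eq_Bolzano_Weierstrass by metis
  then obtain s where s: "\<And>n. s n \<in> endpoints - {s0}" "s \<longlonglongrightarrow> s0"
    unfolding islimpt_sequential by blast
  have "\<exists>t\<in>{0..<1}. t \<noteq> s n \<and> \<gamma> (s n) = \<gamma> t" for n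
    using s(1)[of n] by (auto simp: endpoints_def)
  then obtain t where t: "\<And>n. t n \<in> {0..<1}" "\<And>n. t n \<noteq> s n" "\<And>n. \<gamma> (s n) = \<gamma> (t n)" by metis
  have "t n \<in> {0..1}" for n using t(1)[of n] by auto
  then obtain t0 r where r: "t0 \<in> {0..1}" "strict_mono r" "(t \<circ> r) \<longlonglongrightarrow> t0"
    using compact_Icc[of "0::real" 1] unfolding compact_def by meson
  have tr: "(\<lambda>n. t (r n)) \<longlonglongrightarrow> t0" using r(3) by (simp add: o_def)
  have sr: "(\<lambda>n. s (r n)) \<longlonglongrightarrow> s0" using LIMSEQ_subseq_LIMSEQ[OF s(2) r(2)] by (simp add: o_def)
  have eq: "\<gamma> s0 = \<gamma> t0"
    using tendsto[OF sr] tendsto[OF tr] t(3) LIMSEQ_unique by simp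
  obtain Q where Q: "\<And>y. \<gamma> y - \<gamma> s0 = (y - s0) *\<^sub>R Q y" "\<And>x. x \<longlonglongrightarrow> s0 \<Longrightarrow> (\<lambda>n. Q (x n)) \<longlonglongrightarrow> \<gamma>' s0"
    using secant_slope[OF deriv[of s0]] by metis
  obtain R where R: "\<And>y. \<gamma> y - \<gamma> t0 = (y - t0) *\<^sub>R R y" "\<And>x. x \<longlonglongrightarrow> t0 \<Longrightarrow> (\<lambda>n. R (x n)) \<longlonglongrightarrow> \<gamma>' t0"
    using secant_slope[OF deriv[of t0]] by metis
  have "Q (s (r n)) = ((t (r n) - t0) / (s (r n) - s0)) *\<^sub>R R (t (r n))" for n
  proof -
    have "(s (r n) - s0) *\<^sub>R Q (s (r n)) = (t (r n) - t0) *\<^sub>R R (t (r n))"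
      using Q(1)[of "s (r n)"] R(1)[of "t (r n)"] t(3)[of "r n"] eq by simp
    then have "(1 / (s (r n) - s0)) *\<^sub>R (s (r n) - s0) *\<^sub>R Q (s (r n)) = (1 / (s (r n) - s0)) *\<^sub>R (t (r n) - t0) *\<^sub>R R (t (r n))"
      by simp
    moreover have "s (r n) - s0 \<noteq> 0" using s(1)[of "r n"] by auto
    ultimately show ?thesis by simp
  qed
  then have "(\<lambda>n. ((t (r n) - t0) / (s (r n) - s0)) *\<^sub>R R (t (r n))) \<longlonglongrightarrow> \<gamma>' s0"
    using Q(2)[OF sr] by simp
  then obtain c where c: "\<gamma>' s0 = c *\<^sub>R \<gamma>' t0"
    by (rule parallel_limit[OF _ R(2)[OF tr] immersed])
  have "frac s0 = frac t0"
  proof (rule ccontr)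
    assume "frac s0 \<noteq> frac t0"
    moreover have "\<gamma> (frac s0) = \<gamma> (frac t0)" "\<gamma>' (frac s0) = c *\<^sub>R \<gamma>' (frac t0)"
      using eq c periodic_eq_frac[of \<gamma>, OF periodic] periodic_eq_frac[of \<gamma>', OF deriv_periodic] by simp_all
    ultimately show False using not_parallel[OF frac_in_unit frac_in_unit] by blast
  qed
  \<comment> \<open>The two limit times are one point of the circle; \<open>k\<close> is their integer difference.\<close>
  define k where "k = \<lfloor>s0\<rfloor> - \<lfloor>t0\<rfloor>"
  have k: "s0 = t0 + of_int k" using \<open>frac s0 = frac t0\<close> by (simp add: frac_def k_def)
  obtain e where e: "e > 0" "inj_on \<gamma> {s0 - e<..<s0 + e}" using locally_injective by blast
  have "(\<lambda>n. t (r n) + of_int k) \<longlonglongrightarrow> s0" unfolding k by (intro tendsto_intros tr)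
  then obtain N1 where N1: "\<And>n. n \<ge> N1 \<Longrightarrow> dist (t (r n) + of_int k) s0 < e" using metric_LIMSEQ_D e(1) by blast
  obtain N2 where N2: "\<And>n. n \<ge> N2 \<Longrightarrow> dist (s (r n)) s0 < e" using metric_LIMSEQ_D[OF sr] e(1) by blast
  define n where "n = max N1 N2"
  have "\<gamma> (t (r n) + of_int k) = \<gamma> (s (r n))"
    using periodic_eq_frac[of \<gamma> "t (r n) + of_int k", OF periodic] periodic_eq_frac[of \<gamma> "t (r n)", OF periodic]
      t(3)[of "r n"] by (simp add: frac_def)
  moreover have "t (r n) + of_int k \<in> {s0 - e<..<s0 + e}" "s (r n) \<in> {s0 - e<..<s0 + e}"
    using N1[of n] N2[of n] by (auto simp: n_def dist_real_def abs_less_iff)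
  ultimately have "t (r n) + of_int k = s (r n)" using e(2) by (simp add: inj_on_eq_iff)
  moreover have "frac (t (r n) + of_int k) = frac (t (r n))" by (simp add: frac_def)
  ultimately have "frac (t (r n)) = frac (s (r n))" by simp
  moreover have "s (r n) \<in> {0..<1}" using s(1)[of "r n"] by (auto simp: endpoints_def)
  ultimately have "t (r n) = s (r n)" using t(1)[of "r n"] by (simp add: frac_eq)
  then show False using t(2) by blast
qed

lemma finite_chords: "finite (chords \<gamma>)"
proof (rule finite_subset)
  show "chords \<gamma> \<subseteq> Pow endpoints" unfolding chords_def endpoints_def by force
qed (simp add: finite_endpoints)

end

section \<open>Cross chords depend only on the image of the curve\<close>

text \<open>
  The two open arcs between \<open>p\<close> and \<open>r\<close> have connected images, and the images of the two closed arcs are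
  closed sets that meet in the two end points only.
\<close>
lemma circle_minus_two_points:
  fixes G :: "real \<Rightarrow> 'b::metric_space"
  assumes cont: "continuous_on {0..1} G" and loop: "G 0 = G 1" and inj: "inj_on G {0..<1}"
    and pr: "0 \<le> p" "p < r" "r < 1" and uv: "u \<in> {0..<1} - {p, r}" "v \<in> {0..<1} - {p, r}"
  shows "connected_component (G ` {0..<1} - {G p, G r}) (G u) (G v) \<longleftrightarrow> (u \<in> {p<..<r} \<longleftrightarrow> v \<in> {p<..<r})"
proof -
  define J where "J = G ` {0..<1} - {G p, G r}"
  have sub: "G x \<in> J" if "x \<in> {0..1} - {p, r}" "p = 0 \<longrightarrow> x \<noteq> 1" for x
  proof -
    define y where "y = (if x = 1 then 0 else x)"
    have y: "y \<in> {0..<1}" "G x = G y" "y \<noteq> p" "y \<noteq> r"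
      using that pr loop by (auto simp: y_def)
    then have "G y \<noteq> G p" "G y \<noteq> G r"
      using pr by (simp_all add: inj_on_eq_iff[OF inj])
    then show ?thesis using y by (simp add: J_def)
  qed
  have conn: "connected (G ` S)" if "connected S" "S \<subseteq> {0..1}" for S
    using that cont by (metis connected_continuous_image continuous_on_subset)
  have inside: "connected (G ` {p<..<r})" "G ` {p<..<r} \<subseteq> J"
    using pr by (auto intro!: conn sub)
  \<comment> \<open>The outer arc passes through the base point. If \<open>p\<close> itself is the base point, the arc is a single
    interval.\<close>
  define Out where "Out = (if p = 0 then G ` {r<..<1} else G ` {0..<p} \<union> G ` {r<..1})"
  have Out: "connected Out" "Out \<subseteq> J" "\<And>x. x \<in> {0..<1} - {p..r} \<Longrightarrow> G x \<in> Out"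
  proof -
    have "connected Out"
    proof (cases "p = 0")
      case True
      then show ?thesis using pr by (auto simp: Out_def intro!: conn)
    next
      case False
      have "connected (G ` {0..<p} \<union> G ` {r<..1})"
      proof (rule connected_Un)
        have "G 0 \<in> G ` {0..<p}" "G 1 \<in> G ` {r<..1}" using pr False by auto
        then show "G ` {0..<p} \<inter> G ` {r<..1} \<noteq> {}" using loop by auto
      qed (use pr in \<open>auto intro!: conn\<close>)
      then show ?thesis using False by (simp add: Out_def)
    qed
    then show "connected Out" "Out \<subseteq> J" "\<And>x. x \<in> {0..<1} - {p..r} \<Longrightarrow> G x \<in> Out"
      using pr by (auto simp: Out_def intro!: sub)
  qed
  show ?thesis
    unfolding J_def[symmetric]
  proof
    assume "u \<in> {p<..<r} \<longleftrightarrow> v \<in> {p<..<r}"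
    then consider "u \<in> {p<..<r}" "v \<in> {p<..<r}" | "u \<in> {0..<1} - {p..r}" "v \<in> {0..<1} - {p..r}"
      using uv by fastforce
    then show "connected_component J (G u) (G v)"
    proof cases
      case 1
      then show ?thesis using inside unfolding connected_component_def by blast
    next
      case 2
      then show ?thesis using Out unfolding connected_component_def by blast
    qed
  next
    assume "connected_component J (G u) (G v)"
    then obtain C where C: "connected C" "C \<subseteq> J" "G u \<in> C" "G v \<in> C"
      unfolding connected_component_def by blast
    define I where "I = G ` {p..r}"
    define K where "K = G ` ({0..p} \<union> {r..1})"
    have "closed I" "closed K"
      unfolding I_def K_def using pr
      by (auto intro!: compact_imp_closed compact_continuous_image compact_Un continuous_on_subset[OF cont])
    moreover have "C \<subseteq> I \<union> K"
    proof -
      have "{0..<1} \<subseteq> {p..r} \<union> ({0..p} \<union> {r..1})" by auto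
      then have "G ` {0..<1} \<subseteq> I \<union> K" unfolding I_def K_def by blast
      then show ?thesis using C(2) unfolding J_def by blast
    qed
    moreover have "I \<inter> K \<inter> C = {}"
    proof -
      have "G x \<notin> J" if "x \<in> {p..r}" "y \<in> {0..p} \<union> {r..1}" "G x = G y" for x y
      proof (cases "y = 1")
        case True
        then have "G x = G 0" using that loop by simp
        then have "x = 0" using that pr inj_onD[OF inj, of x 0] by auto
        then show ?thesis using that pr by (auto simp: J_def)
      next
        case False
        then have "x = y" using that pr by (intro inj_onD[OF inj that(3)]) auto
        then have "x = p \<or> x = r" using that by auto
        then show ?thesis by (auto simp: J_def)
      qed
      then show ?thesis using C(2) unfolding I_def K_def by blast
    qed
    ultimately have disj: "I \<inter> C = {} \<or> K \<inter> C = {}"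
      using C(1) unfolding connected_closed by blast
    have "x \<in> {p<..<r} \<or> G x \<in> K" "x \<notin> {p<..<r} \<or> G x \<in> I" if "x \<in> {0..<1} - {p, r}" for x
      using that by (auto simp: I_def K_def)
    then show "u \<in> {p<..<r} \<longleftrightarrow> v \<in> {p<..<r}"
      using disj C(3,4) uv by (metis disjoint_iff)
  qed
qed

lemma chords_intersect_ordered:
  assumes "p < r" "q < s"
  shows "chords_intersect {p, r} {q, s} \<longleftrightarrow> p < q \<and> q < r \<and> r < s \<or> q < p \<and> p < s \<and> s < r"
proof
  assume "chords_intersect {p, r} {q, s}"
  then show "p < q \<and> q < r \<and> r < s \<or> q < p \<and> p < s \<and> s < r"
    using assms unfolding chords_intersect_def by (auto simp: doubleton_eq_iff)
next
  assume "p < q \<and> q < r \<and> r < s \<or> q < p \<and> p < s \<and> s < r"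
  then show "chords_intersect {p, r} {q, s}"
    unfolding chords_intersect_def by blast
qed

lemma chords_intersect_commute: "chords_intersect A B \<longleftrightarrow> chords_intersect B A"
  unfolding chords_intersect_def by blast

lemma chords_cases:
  assumes "A \<in> chords \<gamma>"
  obtains p r where "A = {p, r}" "0 \<le> p" "p < r" "r < 1" "\<gamma> p = \<gamma> r"
proof -
  obtain x y where xy: "A = {x, y}" "x \<in> {0..<1}" "y \<in> {0..<1}" "x \<noteq> y" "\<gamma> x = \<gamma> y"
    using assms unfolding chords_def by blast
  show thesis
  proof (cases "x < y")
    case True
    then show ?thesis using that[of x y] xy by simp
  next
    case False
    then show ?thesis using that[of y x] xy by (simp add: insert_commute)
  qed
qed

text \<open>
  For a simple closed curve \<open>J\<close> and pairs \<open>A\<close>, \<open>B\<close> of its points this says that \<open>A\<close> and \<open>B\<close> alternate on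
  \<open>J\<close>. In this form it refers to no parametrization.
\<close>
definition linked :: "'b::topological_space set \<Rightarrow> 'b set \<Rightarrow> 'b set \<Rightarrow> bool" where
  "linked J A B \<longleftrightarrow> A \<inter> B = {} \<and> (\<exists>u\<in>B. \<exists>v\<in>B. \<not> connected_component (J - A) u v)"

definition fibre_pairs :: "('b::topological_space \<times> 'c::topological_space) set \<Rightarrow> ('b \<times> 'c) set set" where
  "fibre_pairs J = {{x, y} | x y. x \<in> J \<and> y \<in> J \<and> x \<noteq> y \<and> fst x = fst y}"

definition linked_fibre_pairs where
  "linked_fibre_pairs J = {{A, B} | A B. A \<in> fibre_pairs J \<and> B \<in> fibre_pairs J \<and> linked J A B}"

lemma chords_intersect_iff_linked:
  fixes G :: "real \<Rightarrow> 'b::metric_space"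
  assumes cont: "continuous_on {0..1} G" and loop: "G 0 = G 1" and inj: "inj_on G {0..<1}"
    and A: "0 \<le> p" "p < r" "r < 1" and B: "0 \<le> q" "q < s" "s < 1"
  shows "chords_intersect {p, r} {q, s} \<longleftrightarrow> linked (G ` {0..<1}) (G ` {p, r}) (G ` {q, s})"
proof (cases "{p, r} \<inter> {q, s} = {}")
  case True
  have "G ` {p, r} \<inter> G ` {q, s} = {}"
    using True A B by (auto simp: inj_on_eq_iff[OF inj])
  moreover have "connected_component (G ` {0..<1} - G ` {p, r}) (G u) (G v) \<longleftrightarrow> (u \<in> {p<..<r} \<longleftrightarrow> v \<in> {p<..<r})"
    if "u \<in> {q, s}" "v \<in> {q, s}" for u v
  proof -
    have "u \<in> {0..<1} - {p, r}" "v \<in> {0..<1} - {p, r}" using that True A B by auto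
    then show ?thesis
      using circle_minus_two_points[OF cont loop inj A, of u v] by simp
  qed
  moreover have "linked (G ` {0..<1}) (G ` {p, r}) (G ` {q, s}) \<longleftrightarrow> G ` {p, r} \<inter> G ` {q, s} = {} \<and>
      (\<exists>u\<in>{q, s}. \<exists>v\<in>{q, s}. \<not> connected_component (G ` {0..<1} - G ` {p, r}) (G u) (G v))"
    unfolding linked_def by blast
  ultimately have "linked (G ` {0..<1}) (G ` {p, r}) (G ` {q, s}) \<longleftrightarrow>
      (\<exists>u\<in>{q, s}. \<exists>v\<in>{q, s}. \<not> (u \<in> {p<..<r} \<longleftrightarrow> v \<in> {p<..<r}))"
    by blast
  also have "\<dots> \<longleftrightarrow> chords_intersect {p, r} {q, s}"
    unfolding chords_intersect_ordered[OF A(2) B(2)] using True A B by auto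
  finally show ?thesis by simp
next
  case False
  then have "G ` {p, r} \<inter> G ` {q, s} \<noteq> {}" by blast
  moreover have "\<not> chords_intersect {p, r} {q, s}"
    unfolding chords_intersect_ordered[OF A(2) B(2)] using False by auto
  ultimately show ?thesis by (auto simp: linked_def)
qed

text \<open>
  If \<open>G\<close> is a simple closed curve lying above \<open>\<gamma>\<close>, then chords of \<open>\<gamma>\<close> are pairs of points of \<open>G\<close> in one
  fibre, and alternation of chords is the topological linking of these pairs. Hence the number of
  cross chords can be read off from the image of \<open>G\<close>.
\<close>
lemma card_cross_chords_lift:
  fixes G :: "real \<Rightarrow> (real^3) \<times> 'c::metric_space"
  assumes cont: "continuous_on {0..1} G" and loop: "G 0 = G 1" and inj: "inj_on G {0..<1}"
    and fst: "\<And>t. fst (G t) = \<gamma> t"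
  shows "card (cross_chords \<gamma>) = card (linked_fibre_pairs (G ` {0..<1}))"
proof -
  define J where "J = G ` {0..<1}"
  have chords: "fibre_pairs J = (`) G ` chords \<gamma>"
  proof
    show "fibre_pairs J \<subseteq> (`) G ` chords \<gamma>"
    proof
      fix A assume "A \<in> fibre_pairs J"
      then obtain s t where st: "A = {G s, G t}" "s \<in> {0..<1}" "t \<in> {0..<1}" "G s \<noteq> G t" "fst (G s) = fst (G t)"
        unfolding fibre_pairs_def J_def by blast
      then have "{s, t} \<in> chords \<gamma>" unfolding chords_def fst by auto
      then show "A \<in> (`) G ` chords \<gamma>" using st(1) by (intro image_eqI[of _ _ "{s, t}"]) auto
    qed
    show "(`) G ` chords \<gamma> \<subseteq> fibre_pairs J"
    proof clarify
      fix A assume "A \<in> chords \<gamma>"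
      then obtain p r where pr: "A = {p, r}" "0 \<le> p" "p < r" "r < 1" "\<gamma> p = \<gamma> r" by (rule chords_cases)
      then have "G p \<noteq> G r" by (simp add: inj_on_eq_iff[OF inj])
      moreover have "G ` A = {G p, G r}" "G p \<in> J" "G r \<in> J" using pr by (auto simp: J_def)
      ultimately show "G ` A \<in> fibre_pairs J" unfolding fibre_pairs_def using fst pr(5)
        by (intro CollectI exI[of _ "G p"] exI[of _ "G r"]) simp
    qed
  qed
  have linked: "chords_intersect A B \<longleftrightarrow> linked J (G ` A) (G ` B)" if "A \<in> chords \<gamma>" "B \<in> chords \<gamma>" for A B
    using that by (elim chords_cases) (simp only: chords_intersect_iff_linked[OF cont loop inj] J_def)
  have "linked_fibre_pairs J = (`) ((`) G) ` cross_chords \<gamma>"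
  proof -
    have "linked_fibre_pairs J = {{G ` A, G ` B} | A B. A \<in> chords \<gamma> \<and> B \<in> chords \<gamma> \<and> linked J (G ` A) (G ` B)}"
      unfolding linked_fibre_pairs_def chords by blast
    also have "\<dots> = (`) ((`) G) ` cross_chords \<gamma>"
      unfolding cross_chords_def using linked by (auto simp: image_iff) blast+
    finally show ?thesis .
  qed
  moreover have "inj_on ((`) ((`) G)) (cross_chords \<gamma>)"
  proof (rule inj_on_subset[OF inj_on_image_Pow[OF inj_on_image_Pow[OF inj]]])
    show "cross_chords \<gamma> \<subseteq> Pow (Pow {0..<1})"
      unfolding cross_chords_def chords_def by auto
  qed
  ultimately show ?thesis by (simp add: card_image J_def)
qed

text \<open>
  For \<open>v \<noteq> 0\<close> this is the orthogonal projection onto the line spanned by \<open>v\<close>, which encodes that line as a point of a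
  Hausdorff space.
\<close>
definition direction :: "real^3 \<Rightarrow> real^3^3" where
  "direction v = (\<chi> i j. v $ i * v $ j / (v \<bullet> v))"

lemma direction_mult: "direction v *v x = ((v \<bullet> x) / (v \<bullet> v)) *\<^sub>R v"
proof (unfold vec_eq_iff, rule allI)
  fix i
  have "(direction v *v x) $ i = (\<Sum>j\<in>UNIV. v $ i / (v \<bullet> v) * (v $ j * x $ j))"
    by (simp add: direction_def matrix_vector_mult_def mult_ac)
  also have "\<dots> = v $ i / (v \<bullet> v) * (v \<bullet> x)"
    by (simp only: sum_distrib_left[symmetric] inner_vec_def inner_real_def)
  finally show "(direction v *v x) $ i = (((v \<bullet> x) / (v \<bullet> v)) *\<^sub>R v) $ i" by simp
qed

lemma direction_scaleR: "c \<noteq> 0 \<Longrightarrow> direction (c *\<^sub>R v) = direction v"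
  by (simp add: direction_def vec_eq_iff)

lemma direction_eqD:
  assumes "direction v = direction w" "w \<noteq> 0"
  obtains c where "w = c *\<^sub>R v"
proof
  have "direction w *v w = w" using assms(2) by (simp add: direction_mult)
  then show "w = ((v \<bullet> w) / (v \<bullet> v)) *\<^sub>R v"
    using direction_mult[of v w] assms(1) by simp
qed

context transverse_closed_curve
begin

text \<open>
  At a double point the two tangent lines differ, so recording the tangent line resolves the double
  points and turns the curve into a simple closed one.
\<close>
definition lift :: "real \<Rightarrow> (real^3) \<times> (real^3^3)" where
  "lift t = (\<gamma> t, direction (\<gamma>' t))"

lemma lift_continuous: "continuous_on S lift"
proof -
  have "continuous_on S \<gamma>'" using deriv_continuous continuous_on_subset by blast
  then show ?thesis
    unfolding lift_def direction_def using immersed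
    by (intro continuous_intros continuous) auto
qed

lemma lift_periodic: "lift (t + 1) = lift t"
  by (simp add: lift_def periodic deriv_periodic)

lemma lift_inj: "inj_on lift {0..<1}"
proof (rule inj_onI, rule ccontr)
  fix s t assume st: "s \<in> {0..<1}" "t \<in> {0..<1}" "lift s = lift t" "s \<noteq> t"
  then have "\<gamma> s = \<gamma> t" "direction (\<gamma>' t) = direction (\<gamma>' s)" by (simp_all add: lift_def)
  moreover from this obtain c where "\<gamma>' s = c *\<^sub>R \<gamma>' t" using direction_eqD immersed by blast
  ultimately show False using not_parallel st by blast
qed

lemma card_cross_chords: "card (cross_chords \<gamma>) = card (linked_fibre_pairs (range lift))"
proof -
  have "range lift = lift ` {0..<1}" using lift_periodic by (rule range_periodic)
  moreover have "lift 0 = lift 1" using lift_periodic[of 0] by simp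
  ultimately show ?thesis
    using card_cross_chords_lift[OF lift_continuous _ lift_inj, of \<gamma>] by (simp add: lift_def)
qed

end

lemma range_lift_mono:
  assumes "transverse_closed_curve \<gamma> \<gamma>'" "transverse_closed_curve \<delta> \<delta>'" "range \<gamma> \<subseteq> range \<delta>"
  shows "range (transverse_closed_curve.lift \<gamma> \<gamma>') \<subseteq> range (transverse_closed_curve.lift \<delta> \<delta>')"
proof (rule image_subsetI)
  interpret g: transverse_closed_curve \<gamma> \<gamma>' by fact
  interpret d: transverse_closed_curve \<delta> \<delta>' by fact
  fix t
  obtain s c where s: "\<delta> s = \<gamma> t" "\<gamma>' t = c *\<^sub>R \<delta>' s" using tangent_transfer[OF assms] by metis
  then have "c \<noteq> 0" using g.immersed[of t] by auto
  then have "g.lift t = d.lift s" using s by (simp add: g.lift_def d.lift_def direction_scaleR)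
  then show "g.lift t \<in> range d.lift" by simp
qed

text \<open>
  The tangent lines of a curve are determined by its image, hence so is the image of its lift, and
  with it the number of cross chords.
\<close>
theorem card_cross_chords_range:
  assumes "transverse_closed_curve \<gamma> \<gamma>'" "transverse_closed_curve \<delta> \<delta>'" "range \<gamma> = range \<delta>"
  shows "card (cross_chords \<gamma>) = card (cross_chords \<delta>)"
proof -
  have "range (transverse_closed_curve.lift \<gamma> \<gamma>') = range (transverse_closed_curve.lift \<delta> \<delta>')"
    using range_lift_mono[OF assms(1,2)] range_lift_mono[OF assms(2,1)] assms(3) by blast
  then show ?thesis
    using transverse_closed_curve.card_cross_chords[OF assms(1)] transverse_closed_curve.card_cross_chords[OF assms(2)]
    by simp
qed

section \<open>Independence of the parametrization and ambient isotopy\<close>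

lemma smooth_on_open_derivative:
  assumes "smooth_on_open U f" "open U"
  shows "\<exists>F. (\<forall>x\<in>U. (f has_derivative F x) (at x)) \<and> (\<forall>v. continuous_on U (\<lambda>x. F x v))"
proof -
  have cont: "continuous_on U g" if "smooth_on_open U g" for g :: "'a \<Rightarrow> 'b"
    using that
  proof cases
    case (1 F)
    then show ?thesis
      by (intro continuous_at_imp_continuous_on ballI has_derivative_continuous) blast
  qed
  from assms(1) show ?thesis
  proof cases
    case (1 F)
    then show ?thesis using cont by blast
  qed
qed

text \<open>
  The derivative of the left inverse \<open>K\<close> carries the velocities of \<open>\<delta>\<close> back to those of \<open>\<gamma>\<close>, so they can
  neither vanish nor become parallel at a double point.
\<close>
lemma (in transverse_closed_curve) diffeomorphic_image:
  assumes "\<And>t. (\<delta> has_vector_derivative \<delta>' t) (at t)" "continuous_on UNIV \<delta>'"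
    and per: "\<And>t. \<delta> (t + 1) = \<delta> t"
    and K: "\<And>t. K differentiable (at (\<delta> t))" "\<And>t. K (\<delta> t) = \<gamma> t"
  shows "transverse_closed_curve \<delta> \<delta>'"
proof -
  define L where "L t = frechet_derivative K (at (\<delta> t))" for t
  have lin: "linear (L t)" for t unfolding L_def by (rule linear_frechet_derivative[OF K(1)])
  have L: "L t (\<delta>' t) = \<gamma>' t" for t
    using has_vector_derivative_compose_differentiable[OF assms(1) K(1), of t] deriv[of t]
      vector_derivative_unique_at unfolding K(2) L_def by blast
  have immersed': "\<delta>' t \<noteq> 0" for t
    using L[of t] immersed[of t] linear_0[OF lin, of t] by metis
  show ?thesis
  proof
    fix s t assume st: "s \<in> {0..<1}" "t \<in> {0..<1}" "s \<noteq> t" "\<delta> s = \<delta> t"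
    show "\<not> collinear {0, \<delta>' s, \<delta>' t}"
    proof
      assume "collinear {0, \<delta>' s, \<delta>' t}"
      then obtain c where c: "\<delta>' t = c *\<^sub>R \<delta>' s" using immersed' by (auto simp: collinear_lemma)
      have "L t = L s" using st(4) by (simp add: L_def)
      then have "\<gamma>' t = c *\<^sub>R \<gamma>' s"
        using L[of t] L[of s] c linear_cmul[OF lin, of s c "\<delta>' s"] by simp
      moreover have "\<gamma> s = \<gamma> t" using K(2)[of s] K(2)[of t] st(4) by simp
      ultimately show False using transverse[OF st(1-3)] by (auto simp: collinear_lemma)
    qed
  qed (use assms immersed' in auto)
qed

lemma generic_immersion_transverse:
  assumes "generic_immersion \<gamma>"
  shows "transverse_closed_curve \<gamma> (\<lambda>t. vector_derivative \<gamma> (at t))"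
proof -
  obtain U g where U: "UNIV \<subseteq> U" "smooth_on_open U g" "\<And>x. g x = \<gamma> x"
    using assms unfolding generic_immersion_def smooth_on_def by auto
  then have g: "U = UNIV" "g = \<gamma>" by auto
  obtain F where F: "\<And>x. (\<gamma> has_derivative F x) (at x)" "\<And>v. continuous_on UNIV (\<lambda>x. F x v)"
    using smooth_on_open_derivative[OF U(2)] unfolding g by auto
  have deriv: "(\<gamma> has_vector_derivative F t 1) (at t)" for t
  proof -
    have "linear (F t)" using F(1) has_derivative_linear by blast
    then have "F t x = x *\<^sub>R F t 1" for x using linear_cmul[of "F t" x 1] by simp
    then have "F t = (\<lambda>x. x *\<^sub>R F t 1)" by blast
    then show ?thesis using F(1)[of t] unfolding has_vector_derivative_def by simp
  qed
  then have eq: "vector_derivative \<gamma> (at t) = F t 1" for t by (simp add: vector_derivative_at)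
  show ?thesis
    using assms deriv F(2)[of 1]
    unfolding generic_immersion_def transverse_closed_curve_def eq by auto
qed

lemma chords_eq:
  assumes "\<And>s t. \<gamma> s = \<gamma> t \<longleftrightarrow> \<delta> s = \<delta> t"
  shows "chords \<gamma> = chords \<delta>"
  unfolding chords_def assms ..

text \<open>
  All parametrizations of \<open>P\<close> have the same number of cross chords, so the description that defines
  \<^const>\<open>cross_chord_number\<close> is satisfied by exactly one number.
\<close>
lemma cross_chord_number_eq:
  assumes "parametrizes \<gamma> P"
  shows "cross_chord_number P = card (cross_chords \<gamma>)"
  unfolding cross_chord_number_def
proof (rule the_equality)
  show "\<forall>\<delta>. parametrizes \<delta> P \<longrightarrow> card (cross_chords \<delta>) = card (cross_chords \<gamma>)"
    using card_cross_chords_range generic_immersion_transverse assms unfolding parametrizes_def by metis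
qed (use assms in blast)

text \<open>
  The end map of the isotopy carries a parametrization of \<open>P\<close> to a curve with image \<open>Q\<close> and with
  literally the same chords.
\<close>
lemma ambient_isotopic_cross_chord_number:
  assumes "ambient_isotopic P Q"
  shows "cross_chord_number P = cross_chord_number Q"
proof -
  obtain \<gamma> \<delta> where \<gamma>: "parametrizes \<gamma> P" and \<delta>: "parametrizes \<delta> Q"
    using assms unfolding ambient_isotopic_def knot_projection_def by blast
  obtain H :: "real \<Rightarrow> real^3 \<Rightarrow> real^3" where
    H: "smooth_on ({0..1} \<times> S2) (\<lambda>(t, x). H t x)" "\<forall>t\<in>{0..1}. bij_betw (H t) S2 S2 \<and> smooth_on S2 (inv_into S2 (H t))"
      "H 1 ` P = Q"
    using assms unfolding ambient_isotopic_def by blast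
  have bij: "bij_betw (H 1) S2 S2" and inv: "smooth_on S2 (inv_into S2 (H 1))" using H(2) by auto
  define \<gamma>' where "\<gamma>' t = vector_derivative \<gamma> (at t)" for t
  interpret transverse_closed_curve \<gamma> \<gamma>'
    using generic_immersion_transverse \<gamma> unfolding parametrizes_def \<gamma>'_def by blast
  have S2: "\<gamma> t \<in> S2" for t using \<gamma> unfolding parametrizes_def generic_immersion_def by blast
  obtain U g where U: "open U" "{0..1} \<times> S2 \<subseteq> U" "smooth_on_open U g" "\<And>t x. t \<in> {0..1} \<Longrightarrow> x \<in> S2 \<Longrightarrow> g (t, x) = H t x"
    using H(1) unfolding smooth_on_def by (metis (no_types, lifting) SigmaI case_prod_conv)
  obtain F where F: "\<And>x. x \<in> U \<Longrightarrow> (g has_derivative F x) (at x)" "\<And>v. continuous_on U (\<lambda>x. F x v)"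
    using smooth_on_open_derivative[OF U(3,1)] by blast
  obtain V K where K: "open V" "S2 \<subseteq> V" "smooth_on_open V K" "\<And>x. x \<in> S2 \<Longrightarrow> K x = inv_into S2 (H 1) x"
    using inv unfolding smooth_on_def by blast
  obtain F' where F': "\<And>x. x \<in> V \<Longrightarrow> (K has_derivative F' x) (at x)"
    using smooth_on_open_derivative[OF K(3,1)] by blast
  define \<beta> where "\<beta> t = H 1 (\<gamma> t)" for t
  define \<beta>' where "\<beta>' t = F (1, \<gamma> t) (0, \<gamma>' t)" for t
  have inU: "(1, \<gamma> t) \<in> U" for t using U(2) S2 by auto
  have \<beta>g: "\<beta> t = g (1, \<gamma> t)" for t using U(4) S2 by (simp add: \<beta>_def)
  have "transverse_closed_curve \<beta> \<beta>'"
  proof (rule diffeomorphic_image)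
    fix t
    have "((\<lambda>t. (1, \<gamma> t)) has_vector_derivative (0, \<gamma>' t)) (at t)"
      by (intro has_vector_derivative_Pair deriv has_vector_derivative_const)
    then have "((\<lambda>t. g (1, \<gamma> t)) has_vector_derivative F (1, \<gamma> t) (0, \<gamma>' t)) (at t)"
      using vector_derivative_diff_chain_within[of "\<lambda>t. (1, \<gamma> t)" "(0, \<gamma>' t)" t UNIV g "F (1, \<gamma> t)"]
        F(1)[OF inU] by (simp add: o_def has_derivative_at_withinI)
    then show "(\<beta> has_vector_derivative \<beta>' t) (at t)" unfolding \<beta>g[abs_def] \<beta>'_def .
  next
    \<comment> \<open>Directional derivatives are known to be continuous for fixed directions only, so the moving
      direction is expanded in a basis.\<close>
    have "F (1, \<gamma> t) (0, \<gamma>' t) = (\<Sum>b\<in>Basis. (\<gamma>' t \<bullet> b) *\<^sub>R F (1, \<gamma> t) (0, b))" for t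
    proof -
      have lin: "linear (F (1, \<gamma> t))" using F(1)[OF inU] has_derivative_linear by blast
      have "(0 :: real, \<gamma>' t) = (\<Sum>b\<in>Basis. (\<gamma>' t \<bullet> b) *\<^sub>R (0, b))"
        by (simp add: sum_prod euclidean_representation)
      then show ?thesis by (simp only: linear_sum[OF lin] linear_cmul[OF lin])
    qed
    moreover have "continuous_on UNIV (\<lambda>t. F (1, \<gamma> t) v)" for v
      by (rule continuous_on_compose2[OF F(2)]) (use inU in \<open>auto intro!: continuous_intros continuous\<close>)
    ultimately show "continuous_on UNIV \<beta>'"
      unfolding \<beta>'_def[abs_def] by (simp add: continuous_intros deriv_continuous)
  next
    fix t
    show "\<beta> (t + 1) = \<beta> t" by (simp add: \<beta>_def periodic)
    have "\<beta> t \<in> S2" using bij S2 unfolding \<beta>_def bij_betw_def by blast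
    then show "K differentiable (at (\<beta> t))"
      using F' K(2) unfolding differentiable_def by blast
    show "K (\<beta> t) = \<gamma> t"
      using \<open>\<beta> t \<in> S2\<close> K(4)[of "\<beta> t"] bij_betw_inv_into_left[OF bij S2[of t]] by (simp add: \<beta>_def)
  qed
  moreover have "range \<beta> = range \<delta>"
    using \<gamma> \<delta> H(3) unfolding parametrizes_def \<beta>_def by auto
  ultimately have "card (cross_chords \<beta>) = card (cross_chords \<delta>)"
    using card_cross_chords_range generic_immersion_transverse \<delta> unfolding parametrizes_def by blast
  moreover have "chords \<beta> = chords \<gamma>"
    unfolding \<beta>_def using inj_on_eq_iff[OF bij_betw_imp_inj_on[OF bij] S2 S2] by (rule chords_eq)
  then have "cross_chords \<beta> = cross_chords \<gamma>" by (simp add: cross_chords_def)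
  ultimately show ?thesis
    using cross_chord_number_eq[OF \<gamma>] cross_chord_number_eq[OF \<delta>] by simp
qed

section \<open>The first homotopy move\<close>

definition crossing_pairs :: "real set set \<Rightarrow> real set set set" where
  "crossing_pairs C = {{A, B} | A B. A \<in> C \<and> B \<in> C \<and> chords_intersect A B}"

lemma cross_chords_eq_crossing_pairs: "cross_chords \<gamma> = crossing_pairs (chords \<gamma>)"
  by (simp add: cross_chords_def crossing_pairs_def)

lemma not_chords_intersect_self: "\<not> chords_intersect A A"
  unfolding chords_intersect_def by (auto simp: doubleton_eq_iff)

lemma card_crossing_pairs_insert:
  assumes "finite C" "c \<notin> C"
  shows "card (crossing_pairs (insert c C)) = card (crossing_pairs C) + card {A \<in> C. chords_intersect A c}"
proof -
  define N where "N = (\<lambda>A. {A, c}) ` {A \<in> C. chords_intersect A c}"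
  have "crossing_pairs (insert c C) = crossing_pairs C \<union> N"
  proof
    show "crossing_pairs (insert c C) \<subseteq> crossing_pairs C \<union> N"
    proof
      fix X assume "X \<in> crossing_pairs (insert c C)"
      then obtain A B where X: "X = {A, B}" "A \<in> insert c C" "B \<in> insert c C" "chords_intersect A B"
        unfolding crossing_pairs_def by blast
      consider "A \<in> C" "B \<in> C" | "A = c" "B \<in> C" | "A \<in> C" "B = c"
        using X not_chords_intersect_self by blast
      then show "X \<in> crossing_pairs C \<union> N"
      proof cases
        case 1
        then show ?thesis using X unfolding crossing_pairs_def by blast
      next
        case 2
        then have "chords_intersect B c" "X = {B, c}" using X chords_intersect_commute by auto
        then show ?thesis using 2 unfolding N_def by blast
      next
        case 3
        then show ?thesis using X unfolding N_def by blast
      qed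
    qed
    show "crossing_pairs C \<union> N \<subseteq> crossing_pairs (insert c C)"
      unfolding crossing_pairs_def N_def by blast
  qed
  moreover have "crossing_pairs C \<inter> N = {}"
    using assms(2) unfolding crossing_pairs_def N_def by (auto simp: doubleton_eq_iff)
  moreover have "finite (crossing_pairs C)"
    by (rule finite_subset[of _ "Pow C"]) (use assms(1) in \<open>auto simp: crossing_pairs_def\<close>)
  moreover have "finite N" unfolding N_def using assms(1) by simp
  moreover have "card N = card {A \<in> C. chords_intersect A c}"
    unfolding N_def by (intro card_image inj_onI) (auto simp: doubleton_eq_iff)
  ultimately show ?thesis by (simp add: card_Un_disjoint)
qed

definition outer_chords :: "(real \<Rightarrow> real^3) \<Rightarrow> real set \<Rightarrow> real set set" where
  "outer_chords \<gamma> I = {A \<in> chords \<gamma>. A \<inter> I = {}}"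

lemma outer_chords_cong:
  assumes "\<And>t. t \<in> {0..<1} - I \<Longrightarrow> \<gamma>' t = \<gamma> t"
  shows "outer_chords \<gamma>' I = outer_chords \<gamma> I"
proof -
  have "A \<in> outer_chords \<delta>' I"
    if A: "A \<in> outer_chords \<delta> I" and eq: "\<And>t. t \<in> {0..<1} - I \<Longrightarrow> \<delta>' t = \<delta> t" for A \<delta> \<delta>'
  proof -
    obtain s t where st: "A = {s, t}" "s \<in> {0..<1}" "t \<in> {0..<1}" "s \<noteq> t" "\<delta> s = \<delta> t" "A \<inter> I = {}"
      using A unfolding outer_chords_def chords_def by blast
    then have "\<delta>' s = \<delta>' t" using eq[of s] eq[of t] by simp
    then show ?thesis using st unfolding outer_chords_def chords_def by blast
  qed
  from this[of _ \<gamma>' \<gamma>] this[of _ \<gamma> \<gamma>'] show ?thesis using assms by (intro equalityI subsetI) simp_all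
qed

text \<open>
  Whether two chords cross depends only on the cyclic order of their endpoints, and this does not
  change while the endpoints of one chord move within arcs that contain no endpoint of the other.
\<close>
lemma chords_intersect_same_arcs:
  assumes "A \<in> chords \<gamma>" "A \<inter> ({a..b} \<union> {c..d}) = {}" "b < c"
    and "x \<in> {a..b}" "x' \<in> {a..b}" "y \<in> {c..d}" "y' \<in> {c..d}"
  shows "chords_intersect A {x, y} \<longleftrightarrow> chords_intersect A {x', y'}"
proof -
  obtain p r where pr: "A = {p, r}" "p < r" using assms(1) by (rule chords_cases)
  have "x < y" "x' < y'" using assms(3-) by auto
  have off: "p < a \<or> b < p" "p < c \<or> d < p" "r < a \<or> b < r" "r < c \<or> d < r"
    using assms(2) unfolding pr(1) by auto
  have xy: "a \<le> x" "x \<le> b" "a \<le> x'" "x' \<le> b" "c \<le> y" "y \<le> d" "c \<le> y'" "y' \<le> d"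
    using assms(4-) by auto
  then show ?thesis
    unfolding pr(1) chords_intersect_ordered[OF pr(2) \<open>x < y\<close>] chords_intersect_ordered[OF pr(2) \<open>x' < y'\<close>]
    using off xy assms(3) pr(2) by smt
qed

text \<open>
  The new arc contributes a single chord, which has no endpoint of another chord between its own
  endpoints and therefore crosses none.
\<close>
lemma kink_creation_cross_chord_number:
  assumes "kink_creation P P'"
  shows "cross_chord_number P' = cross_chord_number P"
proof -
  obtain \<gamma> \<gamma>' D B a b c d where par: "parametrizes \<gamma> P" "parametrizes \<gamma>' P'"
    and "disk_with_boundary D B" and ab: "0 < a" "b < 1"
    and D: "{t \<in> {0..1}. \<gamma> t \<in> D} = {a..b}"
    and "proper_strand \<gamma> D B a b"
    and D': "{t \<in> {0..1}. \<gamma>' t \<in> D} = {a..b}"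
    and "proper_strand \<gamma>' D B a b"
    and eq: "\<forall>t\<in>{0..1} - {a<..<b}. \<gamma>' t = \<gamma> t" and inj: "inj_on \<gamma> {a..b}"
    and cd: "a < c" "c < d" "d < b" "\<gamma>' c = \<gamma>' d"
    and kink: "\<forall>s\<in>{a..b}. \<forall>t\<in>{a..b}. s < t \<and> \<gamma>' s = \<gamma>' t \<longrightarrow> s = c \<and> t = d"
    using assms unfolding kink_creation_def by (elim exE conjE) (rule that; assumption)
  interpret \<gamma>: transverse_closed_curve \<gamma> "\<lambda>t. vector_derivative \<gamma> (at t)"
    using par(1) generic_immersion_transverse unfolding parametrizes_def by blast
  have in_arc: "s \<in> {a..b} \<longleftrightarrow> \<delta> s \<in> D" if "\<delta> \<in> {\<gamma>, \<gamma>'}" "s \<in> {0..1}" for \<delta> s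
    using D D' that by blast
  have "chords \<gamma> = outer_chords \<gamma> {a..b}"
  proof -
    have "A \<inter> {a..b} = {}" if A: "A \<in> chords \<gamma>" for A
    proof -
      obtain p r where pr: "A = {p, r}" "0 \<le> p" "p < r" "r < 1" "\<gamma> p = \<gamma> r" using A by (rule chords_cases)
      have "p \<in> {a..b} \<longleftrightarrow> r \<in> {a..b}" using in_arc[of \<gamma> p] in_arc[of \<gamma> r] pr by simp
      moreover have "\<not> (p \<in> {a..b} \<and> r \<in> {a..b})" using inj_onD[OF inj pr(5)] pr(3) by blast
      ultimately show ?thesis using pr(1) by blast
    qed
    then show ?thesis unfolding outer_chords_def by blast
  qed
  moreover have "outer_chords \<gamma>' {a..b} = outer_chords \<gamma> {a..b}"
    by (rule outer_chords_cong) (use eq in auto)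
  moreover have "chords \<gamma>' = insert {c, d} (outer_chords \<gamma>' {a..b})"
  proof
    show "chords \<gamma>' \<subseteq> insert {c, d} (outer_chords \<gamma>' {a..b})"
    proof
      fix A assume A: "A \<in> chords \<gamma>'"
      then obtain p r where pr: "A = {p, r}" "0 \<le> p" "p < r" "r < 1" "\<gamma>' p = \<gamma>' r" by (rule chords_cases)
      have "p \<in> {a..b} \<longleftrightarrow> r \<in> {a..b}" using in_arc[of \<gamma>' p] in_arc[of \<gamma>' r] pr by simp
      moreover have "p = c \<and> r = d" if "p \<in> {a..b}" "r \<in> {a..b}" using kink that pr(3,5) by blast
      ultimately show "A \<in> insert {c, d} (outer_chords \<gamma>' {a..b})"
        using A pr(1) unfolding outer_chords_def by blast
    qed
    have "{c, d} \<in> chords \<gamma>'" using cd ab unfolding chords_def by fastforce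
    then show "insert {c, d} (outer_chords \<gamma>' {a..b}) \<subseteq> chords \<gamma>'"
      unfolding outer_chords_def by blast
  qed
  ultimately have chords': "chords \<gamma>' = insert {c, d} (chords \<gamma>)" by simp
  have "\<not> chords_intersect A {c, d}" if A: "A \<in> chords \<gamma>" for A
  proof -
    have "A \<in> outer_chords \<gamma> {a..b}" using A \<open>chords \<gamma> = outer_chords \<gamma> {a..b}\<close> by simp
    then have "A \<inter> {a..b} = {}" by (simp add: outer_chords_def)
    moreover obtain p r where pr: "A = {p, r}" "p < r" using A by (rule chords_cases)
    ultimately have "p < a \<or> b < p" "r < a \<or> b < r" by auto
    then show ?thesis
      unfolding pr(1) chords_intersect_ordered[OF pr(2) cd(2)] using cd(1-3) by linarith
  qed
  then have no: "{A \<in> chords \<gamma>. chords_intersect A {c, d}} = {}" by blast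
  have "c \<in> {a..b}" using cd by auto
  then have "{c, d} \<notin> outer_chords \<gamma> {a..b}" by (simp add: outer_chords_def)
  then have "{c, d} \<notin> chords \<gamma>" using \<open>chords \<gamma> = outer_chords \<gamma> {a..b}\<close> by simp
  then have "card (cross_chords \<gamma>') = card (cross_chords \<gamma>)"
    unfolding cross_chords_eq_crossing_pairs chords'
    unfolding card_crossing_pairs_insert[OF \<gamma>.finite_chords \<open>{c, d} \<notin> chords \<gamma>\<close>] no by simp
  then show ?thesis using par by (simp add: cross_chord_number_eq)
qed

section \<open>Three pairwise crossing strands\<close>

lemma less_3_cases: "(i::nat) < 3 \<Longrightarrow> i = 0 \<or> i = 1 \<or> i = 2"
  by auto

locale strand_triple =
  fixes \<gamma> :: "real \<Rightarrow> real^3" and D B :: "(real^3) set" and a b :: "nat \<Rightarrow> real"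
  assumes generic: "generic_immersion \<gamma>" and strands: "three_strands \<gamma> D B a b"
begin

sublocale transverse_closed_curve \<gamma> "\<lambda>t. vector_derivative \<gamma> (at t)"
  using generic by (rule generic_immersion_transverse)

abbreviation strand :: "nat \<Rightarrow> real set" where "strand i \<equiv> {a i..b i}"

abbreviation \<tau> :: "nat \<Rightarrow> nat \<Rightarrow> real" where "\<tau> \<equiv> crossing_time \<gamma> a b"

definition crossing_chord :: "nat \<Rightarrow> nat \<Rightarrow> real set" where "crossing_chord i j = {\<tau> i j, \<tau> j i}"

lemma strand_bounds:
  "0 < a 0" "b 0 < a 1" "b 1 < a 2" "b 2 < 1" "a 0 < b 0" "a 1 < b 1" "a 2 < b 2"
  using strands unfolding three_strands_def proper_strand_def by simp_all

lemma proper: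
  assumes "i < 3"
  shows "a i < b i" "\<gamma> (a i) \<in> B" "\<gamma> (b i) \<in> B" "inj_on \<gamma> (strand i)"
  using strands assms unfolding three_strands_def proper_strand_def by blast+

lemma in_disk_iff: "t \<in> {0..1} \<Longrightarrow> \<gamma> t \<in> D \<longleftrightarrow> (\<exists>i<3. t \<in> strand i)"
  using strands unfolding three_strands_def by blast

lemma strand_unit: "i < 3 \<Longrightarrow> t \<in> strand i \<Longrightarrow> 0 < t \<and> t < 1"
  using less_3_cases[of i] strand_bounds by auto

lemma strand_in_disk:
  assumes "i < 3"
  shows "\<gamma> ` strand i \<subseteq> D"
proof (rule image_subsetI)
  fix t assume t: "t \<in> strand i"
  then have "t \<in> {0..1}" using strand_unit[OF assms t] by simp
  then show "\<gamma> t \<in> D" using t assms by (auto simp only: in_disk_iff)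
qed

lemma strand_less: "i < j \<Longrightarrow> j < 3 \<Longrightarrow> s \<in> strand i \<Longrightarrow> t \<in> strand j \<Longrightarrow> s < t"
  using less_3_cases[of i] less_3_cases[of j] strand_bounds by auto

lemma crossing_point:
  assumes "i < 3" "j < 3" "i \<noteq> j"
  obtains p where "p \<in> D - B" "\<gamma> ` strand i \<inter> \<gamma> ` strand j = {p}"
proof -
  have "\<forall>i<3. \<forall>j<3. i \<noteq> j \<longrightarrow> (\<exists>p\<in>D - B. \<gamma> ` strand i \<inter> \<gamma> ` strand j = {p})"
    using strands unfolding three_strands_def by (elim conjE)
  then show ?thesis using assms that by blast
qed

lemma crossing_time:
  assumes "i < 3" "j < 3" "i \<noteq> j"
  shows "\<tau> i j \<in> strand i" "\<gamma> (\<tau> i j) \<in> \<gamma> ` strand j"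
    and crossing_time_unique: "\<And>t. t \<in> strand i \<Longrightarrow> \<gamma> t \<in> \<gamma> ` strand j \<Longrightarrow> t = \<tau> i j"
proof -
  obtain p where p: "p \<in> D - B" "\<gamma> ` strand i \<inter> \<gamma> ` strand j = {p}" by (rule crossing_point[OF assms])
  from p(2) have "p \<in> \<gamma> ` strand i" by blast
  then obtain t where t: "t \<in> strand i" "\<gamma> t = p" by blast
  have unique: "t' = t" if "t' \<in> strand i" "\<gamma> t' \<in> \<gamma> ` strand j" for t'
  proof -
    have "\<gamma> t' = \<gamma> t" using that p(2) t(2) by blast
    then show ?thesis using proper(4)[OF assms(1)] that(1) t(1) by (simp add: inj_on_eq_iff)
  qed
  have "\<gamma> t \<in> \<gamma> ` strand j" using t p(2) by blast
  then have eq: "\<tau> i j = t" unfolding crossing_time_def using t(1) unique by (intro the_equality) blast+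
  show "\<tau> i j \<in> strand i" "\<gamma> (\<tau> i j) \<in> \<gamma> ` strand j"
    unfolding eq by fact+
  show "\<And>t. t \<in> strand i \<Longrightarrow> \<gamma> t \<in> \<gamma> ` strand j \<Longrightarrow> t = \<tau> i j"
    unfolding eq by (rule unique)
qed

lemma crossing_times_same_point:
  assumes "i < 3" "j < 3" "i \<noteq> j"
  shows "\<gamma> (\<tau> i j) = \<gamma> (\<tau> j i)"
proof -
  obtain p where "p \<in> D - B" "\<gamma> ` strand i \<inter> \<gamma> ` strand j = {p}" by (rule crossing_point[OF assms])
  moreover have "\<gamma> (\<tau> i j) \<in> \<gamma> ` strand i \<inter> \<gamma> ` strand j"
    using crossing_time(1,2)[OF assms] by simp
  moreover have "\<gamma> (\<tau> j i) \<in> \<gamma> ` strand i \<inter> \<gamma> ` strand j"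
    using crossing_time(1,2)[OF assms(2,1) assms(3)[symmetric]] by simp
  ultimately show ?thesis by simp
qed

lemma strand_end_not_crossing:
  assumes "i < 3" "j < 3" "i \<noteq> j" "t \<in> strand i" "\<gamma> t \<in> B"
  shows "\<gamma> t \<notin> \<gamma> ` strand j"
proof
  assume "\<gamma> t \<in> \<gamma> ` strand j"
  moreover obtain p where p: "p \<in> D - B" "\<gamma> ` strand i \<inter> \<gamma> ` strand j = {p}"
    by (rule crossing_point[OF assms(1-3)])
  ultimately have "\<gamma> t = p" using assms(4) by blast
  then show False using p(1) assms(5) by simp
qed

lemma crossing_time_interior:
  assumes "i < 3" "j < 3" "i \<noteq> j"
  shows "a i < \<tau> i j" "\<tau> i j < b i"
proof -
  have "\<tau> i j \<noteq> a i" "\<tau> i j \<noteq> b i"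
    using strand_end_not_crossing[OF assms, of "\<tau> i j"] crossing_time(1,2)[OF assms] proper(2,3)[OF assms(1)] by auto
  then show "a i < \<tau> i j" "\<tau> i j < b i" using crossing_time(1)[OF assms] by auto
qed

text \<open>
  Two crossings at one time would give a point of the sphere that is passed on all three strands.
\<close>
lemma crossing_times_distinct:
  assumes "i < 3" "j < 3" "k < 3" "i \<noteq> j" "i \<noteq> k" "j \<noteq> k"
  shows "\<tau> i j \<noteq> \<tau> i k"
proof
  assume eq: "\<tau> i j = \<tau> i k"
  have disj: "s \<noteq> t" if "s \<in> strand m" "t \<in> strand n" "m < 3" "n < 3" "m \<noteq> n" for s t m n
    using strand_less[of m n s t] strand_less[of n m t s] that by (cases "m < n") auto
  have mem: "\<tau> i j \<in> strand i" "\<tau> j i \<in> strand j" "\<tau> k i \<in> strand k"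
    using crossing_time(1)[OF assms(1,2,4)] crossing_time(1)[OF assms(2,1) assms(4)[symmetric]]
      crossing_time(1)[OF assms(3,1) assms(5)[symmetric]] by simp_all
  have unit: "\<tau> i j \<in> {0..<1}" "\<tau> j i \<in> {0..<1}" "\<tau> k i \<in> {0..<1}"
    using strand_unit[OF assms(1) mem(1)] strand_unit[OF assms(2) mem(2)] strand_unit[OF assms(3) mem(3)] by auto
  have "\<gamma> (\<tau> i j) = \<gamma> (\<tau> j i)" "\<gamma> (\<tau> i j) = \<gamma> (\<tau> k i)"
    using crossing_times_same_point[OF assms(1,2,4)] crossing_times_same_point[OF assms(1,3,5)] eq by simp_all
  then have "\<tau> i j = \<tau> j i \<or> \<tau> j i = \<tau> k i \<or> \<tau> i j = \<tau> k i"
    using generic unit unfolding generic_immersion_def by metis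
  then show False using disj mem assms by metis
qed

lemma chords_three_strands:
  "chords \<gamma> = insert (crossing_chord 1 2) (insert (crossing_chord 0 2) (insert (crossing_chord 0 1)
     (outer_chords \<gamma> (\<Union>i<3. strand i))))"
proof
  have "crossing_chord i j \<in> chords \<gamma>" if "i < j" "j < 3" for i j
  proof -
    have ij: "i < 3" "j < 3" "i \<noteq> j" using that by auto
    have mem: "\<tau> i j \<in> strand i" "\<tau> j i \<in> strand j"
      using crossing_time(1)[OF ij] crossing_time(1)[OF ij(2,1) ij(3)[symmetric]] by simp_all
    show ?thesis
      unfolding crossing_chord_def chords_def
      using strand_unit[OF ij(1) mem(1)] strand_unit[OF ij(2) mem(2)] strand_less[OF that mem]
        crossing_times_same_point[OF ij]
      by (intro CollectI exI[of _ "\<tau> i j"] exI[of _ "\<tau> j i"]) simp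
  qed
  then have "crossing_chord 0 1 \<in> chords \<gamma>" "crossing_chord 0 2 \<in> chords \<gamma>" "crossing_chord 1 2 \<in> chords \<gamma>"
    by simp_all
  then show "insert (crossing_chord 1 2) (insert (crossing_chord 0 2) (insert (crossing_chord 0 1)
     (outer_chords \<gamma> (\<Union>i<3. strand i)))) \<subseteq> chords \<gamma>"
    by (auto simp: outer_chords_def)
  show "chords \<gamma> \<subseteq> insert (crossing_chord 1 2) (insert (crossing_chord 0 2) (insert (crossing_chord 0 1)
     (outer_chords \<gamma> (\<Union>i<3. strand i))))"
  proof
    fix A assume A: "A \<in> chords \<gamma>"
    then obtain p r where pr: "A = {p, r}" "0 \<le> p" "p < r" "r < 1" "\<gamma> p = \<gamma> r" by (rule chords_cases)
    have iff: "p \<in> (\<Union>i<3. strand i) \<longleftrightarrow> r \<in> (\<Union>i<3. strand i)"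
      using in_disk_iff[of p] in_disk_iff[of r] pr by auto
    show "A \<in> insert (crossing_chord 1 2) (insert (crossing_chord 0 2) (insert (crossing_chord 0 1)
     (outer_chords \<gamma> (\<Union>i<3. strand i))))"
    proof (cases "p \<in> (\<Union>i<3. strand i)")
      case False
      then have "A \<inter> (\<Union>i<3. strand i) = {}" using pr(1) iff by blast
      then show ?thesis using A by (simp add: outer_chords_def)
    next
      case True
      then have "r \<in> (\<Union>i<3. strand i)" using iff by simp
      from UN_E[OF this] obtain j where j: "j \<in> {..<3}" "r \<in> strand j" .
      from UN_E[OF True] obtain i where i: "i \<in> {..<3}" "p \<in> strand i" .
      from i j have ij: "i < 3" "j < 3" "p \<in> strand i" "r \<in> strand j" by simp_all
      have "i \<noteq> j"
        using inj_onD[OF proper(4)[OF ij(1)] pr(5) ij(3)] ij(4) pr(3) by fastforce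
      moreover have "\<not> j < i" using strand_less[of j i r p] ij pr(3) by auto
      ultimately have "i < j" by simp
      have on_j: "\<gamma> p \<in> \<gamma> ` strand j" unfolding pr(5) using ij(4) by (rule imageI)
      have on_i: "\<gamma> r \<in> \<gamma> ` strand i" unfolding pr(5)[symmetric] using ij(3) by (rule imageI)
      have "p = \<tau> i j" by (rule crossing_time_unique[OF ij(1,2) \<open>i \<noteq> j\<close> ij(3) on_j])
      moreover have "r = \<tau> j i" by (rule crossing_time_unique[OF ij(2,1) \<open>i \<noteq> j\<close>[symmetric] ij(4) on_i])
      ultimately have "A = crossing_chord i j" using pr(1) by (simp add: crossing_chord_def)
      moreover have "i = 0 \<and> j = 1 \<or> i = 0 \<and> j = 2 \<or> i = 1 \<and> j = 2" using \<open>i < j\<close> \<open>j < 3\<close> by auto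
      ultimately show ?thesis by blast
    qed
  qed
qed

text \<open>
  Any two of the three chords have endpoints on one common strand, the remaining two endpoints being on
  different strands. Since the strands are traversed one after the other, the two chords cross or not
  according to the order of their endpoints on the common strand. The three pairs have strands 0, 1 and
  2 in common; the order that produces a crossing is reversed on strand 1, as there one of the other two
  endpoints lies before and one after.
\<close>
lemma card_cross_chords_formula:
  defines "Out \<equiv> outer_chords \<gamma> (\<Union>i<3. strand i)"
  shows "card (cross_chords \<gamma>) = card (crossing_pairs Out)
    + card {A \<in> Out. chords_intersect A (crossing_chord 0 1)}
    + card {A \<in> Out. chords_intersect A (crossing_chord 0 2)}
    + card {A \<in> Out. chords_intersect A (crossing_chord 1 2)}
    + of_bool (\<tau> 0 1 < \<tau> 0 2) + of_bool (\<tau> 1 2 < \<tau> 1 0) + of_bool (\<tau> 2 0 < \<tau> 2 1)"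
proof -
  have mem: "\<tau> 0 1 \<in> strand 0" "\<tau> 0 2 \<in> strand 0" "\<tau> 1 0 \<in> strand 1" "\<tau> 1 2 \<in> strand 1"
    "\<tau> 2 0 \<in> strand 2" "\<tau> 2 1 \<in> strand 2"
    using crossing_time(1) by simp_all
  have neq: "\<tau> 0 1 \<noteq> \<tau> 0 2" "\<tau> 1 0 \<noteq> \<tau> 1 2" "\<tau> 2 0 \<noteq> \<tau> 2 1"
    using crossing_times_distinct by simp_all
  have less: "\<tau> 0 i < \<tau> 1 j" "\<tau> 0 i < \<tau> 2 k" "\<tau> 1 j < \<tau> 2 k"
    if "i = 1 \<or> i = 2" "j = 0 \<or> j = 2" "k = 0 \<or> k = 1" for i j k
  proof -
    have "\<tau> 0 i \<in> strand 0" "\<tau> 1 j \<in> strand 1" "\<tau> 2 k \<in> strand 2"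
      using that mem by metis+
    note ijk = this
    show "\<tau> 0 i < \<tau> 1 j" by (rule strand_less[OF _ _ ijk(1,2)]) simp_all
    show "\<tau> 0 i < \<tau> 2 k" by (rule strand_less[OF _ _ ijk(1,3)]) simp_all
    show "\<tau> 1 j < \<tau> 2 k" by (rule strand_less[OF _ _ ijk(2,3)]) simp_all
  qed
  have int: "chords_intersect (crossing_chord 0 1) (crossing_chord 0 2) \<longleftrightarrow> \<tau> 0 1 < \<tau> 0 2"
    "chords_intersect (crossing_chord 0 1) (crossing_chord 1 2) \<longleftrightarrow> \<tau> 1 2 < \<tau> 1 0"
    "chords_intersect (crossing_chord 0 2) (crossing_chord 1 2) \<longleftrightarrow> \<tau> 2 0 < \<tau> 2 1"
    unfolding crossing_chord_def
    using less[of 1 0 0] less[of 1 0 1] less[of 2 0 0] less[of 1 2 0] less[of 1 2 1] less[of 2 2 0] less[of 2 2 1]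
    by (simp_all add: chords_intersect_ordered del: One_nat_def)
  have fin: "finite Out"
    unfolding Out_def outer_chords_def using finite_chords by simp
  have out: "crossing_chord i j \<notin> Out" if "i < 3" "j < 3" "i \<noteq> j" for i j
  proof
    assume "crossing_chord i j \<in> Out"
    then have "crossing_chord i j \<inter> (\<Union>i<3. strand i) = {}" by (simp add: Out_def outer_chords_def)
    moreover have "\<tau> i j \<in> crossing_chord i j" by (simp add: crossing_chord_def)
    moreover have "\<tau> i j \<in> (\<Union>i<3. strand i)"
      using that(1) crossing_time(1)[OF that] by (intro UN_I[of i]) simp_all
    ultimately show False by (metis IntI emptyE)
  qed
  have ne: "crossing_chord 0 1 \<noteq> crossing_chord 0 2" "crossing_chord 0 1 \<noteq> crossing_chord 1 2"
      "crossing_chord 0 2 \<noteq> crossing_chord 1 2"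
    using less[of 1 0 0] less[of 1 2 0] less[of 2 2 1] less[of 1 0 1] less[of 2 0 0] neq unfolding crossing_chord_def
    by (auto simp: doubleton_eq_iff simp del: One_nat_def)
  have filter: "card {A \<in> insert c C. chords_intersect A d} = card {A \<in> C. chords_intersect A d} + of_bool (chords_intersect c d)"
    if "finite C" "c \<notin> C" for c C d
  proof -
    have "{A \<in> insert c C. chords_intersect A d} = (if chords_intersect c d then insert c {A \<in> C. chords_intersect A d} else {A \<in> C. chords_intersect A d})"
      by auto
    then show ?thesis using that by simp
  qed
  define c where "c = crossing_chord 0 1"
  define c' where "c' = crossing_chord 0 2"
  define c'' where "c'' = crossing_chord 1 2"
  have n: "c \<notin> Out" "c' \<notin> insert c Out" "c'' \<notin> insert c' (insert c Out)"
    using out[of 0 1] out[of 0 2] out[of 1 2] ne unfolding c_def c'_def c''_def by auto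
  have f: "finite Out" "finite (insert c Out)" "finite (insert c' (insert c Out))" using fin by simp_all
  have "card (cross_chords \<gamma>) = card (crossing_pairs (insert c'' (insert c' (insert c Out))))"
    unfolding cross_chords_eq_crossing_pairs chords_three_strands Out_def c_def c'_def c''_def ..
  then show ?thesis
    unfolding card_crossing_pairs_insert[OF f(3) n(3)] card_crossing_pairs_insert[OF f(2) n(2)]
      card_crossing_pairs_insert[OF f(1) n(1)] filter[OF f(2) n(2)] filter[OF f(1) n(1)]
    unfolding c_def c'_def c''_def int by simp
qed

end

context strand_triple
begin

lemma path_piece_connected:
  assumes "{u..v} \<subseteq> strand i" "i < 3" "A \<inter> \<gamma> ` {u..v} = {}" "s \<in> {u..v}" "t \<in> {u..v}"
  shows "connected_component (D - A) (\<gamma> s) (\<gamma> t)"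
proof -
  have "connected (\<gamma> ` {u..v})" by (intro connected_continuous_image continuous) simp
  moreover have "\<gamma> ` {u..v} \<subseteq> D - A"
    using strand_in_disk[OF assms(2)] image_mono[OF assms(1), of \<gamma>] assms(3) by blast
  ultimately show ?thesis
    unfolding connected_component_def using assms(4,5) by blast
qed

lemma piece_misses_strand:
  assumes "i < 3" "j < 3" "i \<noteq> j" "{u..v} \<subseteq> strand i" "\<tau> i j \<notin> {u..v}"
  shows "\<gamma> ` strand j \<inter> \<gamma> ` {u..v} = {}"
proof (rule ccontr)
  assume "\<gamma> ` strand j \<inter> \<gamma> ` {u..v} \<noteq> {}"
  then obtain x where x: "x \<in> \<gamma> ` strand j" "x \<in> \<gamma> ` {u..v}" by (meson disjoint_iff)
  from x(2) obtain t where "x = \<gamma> t" "t \<in> {u..v}" by (rule imageE)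
  with x(1) have t: "t \<in> {u..v}" "\<gamma> t \<in> \<gamma> ` strand j" by simp_all
  have "t = \<tau> i j" by (rule crossing_time_unique[OF assms(1-3) subsetD[OF assms(4) t(1)] t(2)])
  then show False using t(1) assms(5) by simp
qed

lemma crossing_on_side_of_nearer_end:
  assumes "i < 3" "j < 3" "k < 3" "i \<noteq> j" "i \<noteq> k" "j \<noteq> k"
  shows "connected_component (D - \<gamma> ` strand k) (\<gamma> (\<tau> i j)) (\<gamma> (if \<tau> i j < \<tau> i k then a i else b i))"
proof (cases "\<tau> i j < \<tau> i k")
  case True
  note inside = crossing_time_interior[OF assms(1,2,4)]
  then have sub: "{a i..\<tau> i j} \<subseteq> strand i" by simp
  have "\<gamma> ` strand k \<inter> \<gamma> ` {a i..\<tau> i j} = {}"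
    using True by (intro piece_misses_strand[OF assms(1,3,5) sub]) simp
  then have "connected_component (D - \<gamma> ` strand k) (\<gamma> (\<tau> i j)) (\<gamma> (a i))"
    by (rule path_piece_connected[OF sub assms(1)]) (use inside in simp_all)
  then show ?thesis using True by simp
next
  case False
  then have later: "\<tau> i k < \<tau> i j" using crossing_times_distinct[OF assms] by simp
  note inside = crossing_time_interior[OF assms(1,2,4)]
  then have sub: "{\<tau> i j..b i} \<subseteq> strand i" by simp
  have "\<gamma> ` strand k \<inter> \<gamma> ` {\<tau> i j..b i} = {}"
    using later by (intro piece_misses_strand[OF assms(1,3,5) sub]) simp
  then have "connected_component (D - \<gamma> ` strand k) (\<gamma> (\<tau> i j)) (\<gamma> (b i))"
    by (rule path_piece_connected[OF sub assms(1)]) (use inside in simp_all)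
  then show ?thesis using False by simp
qed

text \<open>
  Follow strand \<open>k\<close> from its start to the crossing with strand \<open>i\<close>, then strand \<open>i\<close> away from its crossing
  with strand \<open>j\<close>, up to the boundary.
\<close>
lemma start_on_side_of_first_crossed_strand:
  assumes "i < 3" "j < 3" "k < 3" "i \<noteq> j" "i \<noteq> k" "j \<noteq> k" and first: "\<tau> k i < \<tau> k j"
  shows "connected_component (D - \<gamma> ` strand j) (\<gamma> (a k)) (\<gamma> (if \<tau> i j < \<tau> i k then b i else a i))"
proof -
  note inside = crossing_time_interior[OF assms(3,1) assms(5)[symmetric]]
  then have sub: "{a k..\<tau> k i} \<subseteq> strand k" by simp
  have "\<gamma> ` strand j \<inter> \<gamma> ` {a k..\<tau> k i} = {}"
    using first by (intro piece_misses_strand[OF assms(3,2) assms(6)[symmetric] sub]) simp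
  then have "connected_component (D - \<gamma> ` strand j) (\<gamma> (a k)) (\<gamma> (\<tau> k i))"
    by (rule path_piece_connected[OF sub assms(3)]) (use inside in simp_all)
  also have "\<gamma> (\<tau> k i) = \<gamma> (\<tau> i k)"
    using crossing_times_same_point[OF assms(3,1) assms(5)[symmetric]] .
  finally have 1: "connected_component (D - \<gamma> ` strand j) (\<gamma> (a k)) (\<gamma> (\<tau> i k))" .
  have "connected_component (D - \<gamma> ` strand j) (\<gamma> (\<tau> i k)) (\<gamma> (if \<tau> i k < \<tau> i j then a i else b i))"
    by (rule crossing_on_side_of_nearer_end) (use assms in auto)
  moreover have "(if \<tau> i k < \<tau> i j then a i else b i) = (if \<tau> i j < \<tau> i k then b i else a i)"
    using crossing_times_distinct[OF assms(1-6)] by auto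
  ultimately show ?thesis using connected_component_trans[OF 1] by simp
qed

lemma strand_separates_ends:
  assumes "disk_with_boundary D B" "i < 3" "j < 3" "i \<noteq> j"
  shows "\<not> connected_component (D - \<gamma> ` strand j) (\<gamma> (a i)) (\<gamma> (b i))"
proof (rule transverse_arc_separates_disk[OF assms(1)])
  note ji = assms(3,2) assms(4)[symmetric]
  show "a i < \<tau> i j" "\<tau> i j < b i" using crossing_time_interior[OF assms(2-4)] .
  show "a j < \<tau> j i" "\<tau> j i < b j" using crossing_time_interior[OF ji] .
  show "\<gamma> (\<tau> i j) = \<gamma> (\<tau> j i)" using crossing_times_same_point[OF assms(2-4)] .
  show "x = \<tau> i j \<and> y = \<tau> j i" if "x \<in> strand i" "y \<in> strand j" "\<gamma> x = \<gamma> y" for x y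
  proof
    show "x = \<tau> i j"
      using crossing_time_unique[OF assms(2-4) that(1)] that(2,3) by simp
    show "y = \<tau> j i"
      using crossing_time_unique[OF ji that(2)] that(1) that(3)[symmetric] by simp
  qed
  have mem: "\<tau> i j \<in> strand i" "\<tau> j i \<in> strand j"
    using crossing_time(1)[OF assms(2-4)] crossing_time(1)[OF ji] .
  have "\<tau> i j \<noteq> \<tau> j i"
    using strand_less[of i j "\<tau> i j" "\<tau> j i"] strand_less[of j i "\<tau> j i" "\<tau> i j"] mem assms(2-4)
    by (cases "i < j") auto
  moreover have "\<tau> i j \<in> {0..<1}" "\<tau> j i \<in> {0..<1}"
    using strand_unit[OF assms(2) mem(1)] strand_unit[OF assms(3) mem(2)] by simp_all
  ultimately show "\<not> collinear {0, vector_derivative \<gamma> (at (\<tau> i j)), vector_derivative \<gamma> (at (\<tau> j i))}"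
    using transverse crossing_times_same_point[OF assms(2-4)] by simp
qed (use proper strand_in_disk assms deriv continuous in auto)

end

section \<open>The third homotopy move\<close>

text \<open>
  The push reverses the order of the two crossings on each of the three strands, so each of the three
  indicators in \<open>card_cross_chords_formula\<close> changes its value, while all other terms remain. The triangle is
  coherent exactly when the three indicators agree; then their sum changes between 0 and 3, and otherwise
  between 1 and 2.
\<close>
lemma strand_push_cross_chord_number:
  assumes gen: "generic_immersion \<gamma>" "generic_immersion \<gamma>'" and push: "strand_pushed \<gamma> \<gamma>' D B a b"
  shows "\<bar>int (card (cross_chords \<gamma>')) - int (card (cross_chords \<gamma>))\<bar> = (if coherent_triangle \<gamma> a b then 3 else 1)"
proof -
  have disk: "disk_with_boundary D B"
    and strands: "three_strands \<gamma> D B a b" "three_strands \<gamma>' D B a b"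
    and same: "\<And>t. t \<in> {0..1} - {a 2<..<b 2} \<Longrightarrow> \<gamma>' t = \<gamma> t"
    and sides: "\<And>p z. p \<in> \<gamma> ` {a 0..b 0} \<inter> \<gamma> ` {a 1..b 1} \<Longrightarrow> z \<in> B - {\<gamma> (a 2), \<gamma> (b 2)} \<Longrightarrow>
        connected_component (D - \<gamma>' ` {a 2..b 2}) p z \<longleftrightarrow> \<not> connected_component (D - \<gamma> ` {a 2..b 2}) p z"
    using push unfolding strand_pushed_def by blast+
  interpret G: strand_triple \<gamma> D B a b by unfold_locales (fact gen strands)+
  interpret G': strand_triple \<gamma>' D B a b by unfold_locales (fact gen strands)+
  define \<tau> where "\<tau> = crossing_time \<gamma> a b"
  define \<tau>' where "\<tau>' = crossing_time \<gamma>' a b"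
  have keep: "\<gamma>' t = \<gamma> t" if "i \<in> {0, 1}" "t \<in> {a i..b i}" for i t
    using that G.strand_bounds by (intro same) auto
  then have image: "\<gamma>' ` {a i..b i} = \<gamma> ` {a i..b i}" if "i \<in> {0, 1}" for i
    using that by (intro image_cong) auto
  have ends: "\<gamma>' (a 2) = \<gamma> (a 2)" using G.strand_bounds by (intro same) auto
  have \<tau>'_eq: "\<tau>' i j = \<tau> i j" if "i \<in> {0, 1}" "j \<in> {0, 1}" "i \<noteq> j" for i j
  proof -
    have ij: "i < 3" "j < 3" using that by auto
    note m = G.crossing_time(1,2)[OF ij that(3)]
    have "\<tau> i j = \<tau>' i j"
      unfolding \<tau>_def \<tau>'_def using m keep[OF that(1) m(1)] image[OF that(2)]
      by (intro G'.crossing_time_unique[OF ij that(3)]) simp_all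
    then show ?thesis ..
  qed
  have distinct: "\<tau> i j \<noteq> \<tau> i k" "\<tau>' i j \<noteq> \<tau>' i k" if "i < 3" "j < 3" "k < 3" "i \<noteq> j" "i \<noteq> k" "j \<noteq> k" for i j k
    unfolding \<tau>_def \<tau>'_def using G.crossing_times_distinct[OF that] G'.crossing_times_distinct[OF that] .
  \<comment> \<open>On strands 0 and 1: the crossing point \<open>p\<close> lies on the same side of strand 2 as that end of the
    strand which is reached from \<open>p\<close> without meeting strand 2, and the push changes the side.\<close>
  have flip: "\<tau>' i j < \<tau>' i 2 \<longleftrightarrow> \<not> \<tau> i j < \<tau> i 2" if ij: "i \<in> {0, 1}" "j \<in> {0, 1}" "i \<noteq> j" for i j
  proof -
    define p where "p = \<gamma> (\<tau> i j)"
    have lt: "i < 3" "j < 3" "(2::nat) < 3" "i \<noteq> 2" "j \<noteq> 2" using ij by auto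
    note m = G.crossing_time(1,2)[OF lt(1,2) ij(3)]
    have p: "p \<in> \<gamma> ` {a 0..b 0} \<inter> \<gamma> ` {a 1..b 1}"
      using m ij unfolding p_def \<tau>_def by auto
    have p': "\<gamma>' (\<tau>' i j) = p"
      unfolding \<tau>'_eq[OF ij] p_def \<tau>_def using keep[OF ij(1) m(1)] .
    have e: "a i \<in> {a i..b i}" "b i \<in> {a i..b i}" using G.proper(1)[OF lt(1)] by auto
    have side: "z \<in> B - {\<gamma> (a 2), \<gamma> (b 2)}" if "z = \<gamma> (a i) \<or> z = \<gamma> (b i)" for z
    proof -
      have "\<gamma> (a i) \<notin> \<gamma> ` {a 2..b 2}" "\<gamma> (b i) \<notin> \<gamma> ` {a 2..b 2}"
        using G.strand_end_not_crossing[OF lt(1,3,4)] e G.proper(2,3)[OF lt(1)] by blast+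
      moreover have "\<gamma> (a 2) \<in> \<gamma> ` {a 2..b 2}" "\<gamma> (b 2) \<in> \<gamma> ` {a 2..b 2}"
        using G.proper(1)[OF lt(3)] by auto
      ultimately show ?thesis using that G.proper(2,3)[OF lt(1)] by auto
    qed
    have "connected_component (D - \<gamma> ` {a 2..b 2}) p (\<gamma> (if \<tau> i j < \<tau> i 2 then a i else b i))"
      using G.crossing_on_side_of_nearer_end[OF lt(1-3) ij(3) lt(4,5)] by (simp add: p_def \<tau>_def)
    moreover have "connected_component (D - \<gamma>' ` {a 2..b 2}) p (\<gamma> (if \<tau>' i j < \<tau>' i 2 then a i else b i))"
      using G'.crossing_on_side_of_nearer_end[OF lt(1-3) ij(3) lt(4,5)] p' keep[OF ij(1) e(1)] keep[OF ij(1) e(2)]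
      by (simp add: \<tau>'_def split: if_splits)
    ultimately show ?thesis
      using sides[OF p side] by (auto split: if_splits)
  qed
  \<comment> \<open>On strand 2: if strand \<open>i\<close> were met first both before and after the push, then the start of strand 2
    could be joined to one end of strand \<open>i\<close> before, and to the other end after the push, in both cases
    without meeting strand \<open>j\<close>, which separates these ends.\<close>
  have no_repeat: "\<not> (\<tau> 2 i < \<tau> 2 j \<and> \<tau>' 2 i < \<tau>' 2 j)" if ij: "i \<in> {0, 1}" "j \<in> {0, 1}" "i \<noteq> j" for i j
  proof
    assume first: "\<tau> 2 i < \<tau> 2 j \<and> \<tau>' 2 i < \<tau>' 2 j"
    have lt: "i < 3" "j < 3" "(2::nat) < 3" "i \<noteq> j" "i \<noteq> 2" "j \<noteq> 2" using ij by auto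
    have e: "a i \<in> {a i..b i}" "b i \<in> {a i..b i}" using G.proper(1)[OF lt(1)] by auto
    have "connected_component (D - \<gamma> ` {a j..b j}) (\<gamma> (a 2)) (\<gamma> (if \<tau> i j < \<tau> i 2 then b i else a i))"
      using G.start_on_side_of_first_crossed_strand[OF lt] first by (simp add: \<tau>_def)
    moreover have "connected_component (D - \<gamma> ` {a j..b j}) (\<gamma> (a 2)) (\<gamma> (if \<tau>' i j < \<tau>' i 2 then b i else a i))"
      using G'.start_on_side_of_first_crossed_strand[OF lt] first image[OF ij(2)] ends keep[OF ij(1) e(1)] keep[OF ij(1) e(2)]
      by (simp add: \<tau>'_def split: if_splits)
    ultimately have "connected_component (D - \<gamma> ` {a j..b j}) (\<gamma> (a i)) (\<gamma> (b i))"
      using flip[OF ij] by (auto split: if_splits intro: connected_component_trans connected_component_sym)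
    then show False using G.strand_separates_ends[OF disk lt(1,2,4)] by simp
  qed
  have flips: "\<tau>' 0 1 < \<tau>' 0 2 \<longleftrightarrow> \<not> \<tau> 0 1 < \<tau> 0 2" "\<tau>' 1 2 < \<tau>' 1 0 \<longleftrightarrow> \<not> \<tau> 1 2 < \<tau> 1 0"
    "\<tau>' 2 0 < \<tau>' 2 1 \<longleftrightarrow> \<not> \<tau> 2 0 < \<tau> 2 1"
  proof -
    have ne: "\<tau> 1 0 \<noteq> \<tau> 1 2" "\<tau>' 1 0 \<noteq> \<tau>' 1 2" "\<tau> 2 0 \<noteq> \<tau> 2 1" "\<tau>' 2 0 \<noteq> \<tau>' 2 1"
      by (rule distinct; simp)+
    show "\<tau>' 0 1 < \<tau>' 0 2 \<longleftrightarrow> \<not> \<tau> 0 1 < \<tau> 0 2" by (rule flip) simp_all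
    have "\<tau>' 1 0 < \<tau>' 1 2 \<longleftrightarrow> \<not> \<tau> 1 0 < \<tau> 1 2" by (rule flip) simp_all
    then show "\<tau>' 1 2 < \<tau>' 1 0 \<longleftrightarrow> \<not> \<tau> 1 2 < \<tau> 1 0" using ne(1,2) by argo
    have "\<not> (\<tau> 2 0 < \<tau> 2 1 \<and> \<tau>' 2 0 < \<tau>' 2 1)" "\<not> (\<tau> 2 1 < \<tau> 2 0 \<and> \<tau>' 2 1 < \<tau>' 2 0)"
      by (rule no_repeat; simp)+
    then show "\<tau>' 2 0 < \<tau>' 2 1 \<longleftrightarrow> \<not> \<tau> 2 0 < \<tau> 2 1" using ne(3,4) by argo
  qed
  define E where "E = outer_chords \<gamma> (\<Union>i<3. {a i..b i})"
  have E': "outer_chords \<gamma>' (\<Union>i<3. {a i..b i}) = E"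
    unfolding E_def
  proof (intro outer_chords_cong same)
    fix t assume t: "t \<in> {0..<1} - (\<Union>i<3. {a i..b i})"
    have "t \<notin> {a 2..b 2}"
    proof
      assume "t \<in> {a 2..b 2}"
      then have "t \<in> (\<Union>i<3. {a i..b i})" by (intro UN_I[of 2]) simp_all
      then show False using t by (rule DiffD2[rotated])
    qed
    then show "t \<in> {0..1} - {a 2<..<b 2}" using DiffD1[OF t] by auto
  qed
  have arcs: "chords_intersect A (G'.crossing_chord i j) \<longleftrightarrow> chords_intersect A (G.crossing_chord i j)"
    if "A \<in> E" "i < j" "j < 3" for A i j
  proof -
    have ij: "i < 3" "j < 3" "i \<noteq> j" using that by auto
    have A: "A \<in> chords \<gamma>" "A \<inter> (\<Union>i<3. {a i..b i}) = {}" using that(1) by (auto simp: E_def outer_chords_def)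
    have "A \<inter> ({a i..b i} \<union> {a j..b j}) = {}" using A(2) ij by blast
    moreover have "b i < a j"
      using G.strand_less[OF that(2,3), of "b i" "a j"] G.proper(1)[OF ij(1)] G.proper(1)[OF ij(2)] by simp
    ultimately show ?thesis
      unfolding G.crossing_chord_def G'.crossing_chord_def
      by (rule chords_intersect_same_arcs[OF A(1)])
        (use G.crossing_time(1) G'.crossing_time(1) ij in \<open>metis+\<close>)
  qed
  have count: "card {A \<in> E. chords_intersect A (G'.crossing_chord i j)} = card {A \<in> E. chords_intersect A (G.crossing_chord i j)}"
    if "i < j" "j < 3" for i j
    using arcs[OF _ that] by (intro arg_cong[where f = card]) blast
  define N where "N = card (crossing_pairs E) + card {A \<in> E. chords_intersect A (G.crossing_chord 0 1)}
    + card {A \<in> E. chords_intersect A (G.crossing_chord 0 2)} + card {A \<in> E. chords_intersect A (G.crossing_chord 1 2)}"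
  have X: "card (cross_chords \<gamma>) = N + of_bool (\<tau> 0 1 < \<tau> 0 2) + of_bool (\<tau> 1 2 < \<tau> 1 0) + of_bool (\<tau> 2 0 < \<tau> 2 1)"
    unfolding G.card_cross_chords_formula E_def[symmetric] N_def \<tau>_def ..
  have X': "card (cross_chords \<gamma>') = N + of_bool (\<not> \<tau> 0 1 < \<tau> 0 2) + of_bool (\<not> \<tau> 1 2 < \<tau> 1 0) + of_bool (\<not> \<tau> 2 0 < \<tau> 2 1)"
    unfolding G'.card_cross_chords_formula E' N_def flips[symmetric] \<tau>'_def
    using count[of 0 1] count[of 0 2] count[of 1 2] by simp
  have coherent: "coherent_triangle \<gamma> a b \<longleftrightarrow>
      (\<tau> 0 1 < \<tau> 0 2 \<and> \<tau> 2 0 < \<tau> 2 1 \<and> \<tau> 1 2 < \<tau> 1 0) \<or> (\<not> \<tau> 0 1 < \<tau> 0 2 \<and> \<not> \<tau> 2 0 < \<tau> 2 1 \<and> \<not> \<tau> 1 2 < \<tau> 1 0)"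
    using distinct[of 0 1 2] distinct[of 1 0 2] distinct[of 2 0 1]
    unfolding coherent_triangle_def Let_def \<tau>_def by (auto simp: not_less order.order_iff_strict)
  show ?thesis
    unfolding X X' coherent
    by (cases "\<tau> 0 1 < \<tau> 0 2"; cases "\<tau> 1 2 < \<tau> 1 0"; cases "\<tau> 2 0 < \<tau> 2 1"; simp only: of_bool_eq simp_thms if_True if_False; simp)
qed

theorem theorem2:
  shows "(\<forall>P P'. first_move P P' \<longrightarrow> cross_chord_number P' = cross_chord_number P)
    \<and> (\<forall>P P'. strong_third_move P P' \<longrightarrow>
          \<bar>int (cross_chord_number P') - int (cross_chord_number P)\<bar> = 3)
    \<and> (\<forall>P P'. weak_third_move P P' \<longrightarrow>
          \<bar>int (cross_chord_number P') - int (cross_chord_number P)\<bar> = 1)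
    \<and> (\<forall>P Q. strong_13_homotopic P Q \<longrightarrow>
          cross_chord_number P mod 3 = cross_chord_number Q mod 3)"
proof -
  have isotopy: "\<exists>Q Q'. R Q Q' \<and> cross_chord_number P = cross_chord_number Q \<and> cross_chord_number P' = cross_chord_number Q'"
    if "up_to_isotopy R P P'" for R P P'
    using that ambient_isotopic_cross_chord_number unfolding up_to_isotopy_def by metis
  have first: "cross_chord_number P' = cross_chord_number P" if "first_move P P'" for P P'
    using isotopy[OF that[unfolded first_move_def]] kink_creation_cross_chord_number by auto
  have push: "\<bar>int (cross_chord_number Q') - int (cross_chord_number Q)\<bar> = (if coherent_triangle \<gamma> a b then 3 else 1)"
    if "parametrizes \<gamma> Q" "parametrizes \<gamma>' Q'" "strand_pushed \<gamma> \<gamma>' D B a b" for Q Q' \<gamma> \<gamma>' D B a b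
    using strand_push_cross_chord_number[OF _ _ that(3)] that(1,2)
    by (simp add: cross_chord_number_eq parametrizes_def)
  have strong: "\<bar>int (cross_chord_number P') - int (cross_chord_number P)\<bar> = 3" if "strong_third_move P P'" for P P'
    using isotopy[OF that[unfolded strong_third_move_def]] push by fastforce
  have weak: "\<bar>int (cross_chord_number P') - int (cross_chord_number P)\<bar> = 1" if "weak_third_move P P'" for P P'
    using isotopy[OF that[unfolded weak_third_move_def]] push by fastforce
  have mod_eq: "cross_chord_number P mod 3 = cross_chord_number Q mod 3"
    if "ambient_isotopic P Q \<or> first_move P Q \<or> strong_third_move P Q" for P Q
    using that
  proof (elim disjE)
    assume "strong_third_move P Q"
    from strong[OF this] have "cross_chord_number Q = cross_chord_number P + 3 \<or> cross_chord_number P = cross_chord_number Q + 3"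
      by linarith
    then show ?thesis by auto
  qed (use ambient_isotopic_cross_chord_number first in auto)
  have "cross_chord_number P mod 3 = cross_chord_number Q mod 3" if "strong_13_homotopic P Q" for P Q
  proof -
    have "equivclp (\<lambda>P Q. ambient_isotopic P Q \<or> first_move P Q \<or> strong_third_move P Q) P Q"
      using that unfolding strong_13_homotopic_def by blast
    then show ?thesis
    proof (induction rule: equivclp_induct)
      case (step y z)
      from step(2) have "cross_chord_number y mod 3 = cross_chord_number z mod 3"
      proof
        assume "ambient_isotopic y z \<or> first_move y z \<or> strong_third_move y z"
        then show ?thesis by (rule mod_eq)
      next
        assume "ambient_isotopic z y \<or> first_move z y \<or> strong_third_move z y"
        then show ?thesis by (rule mod_eq[symmetric])
      qed
      then show ?case using step.IH by simp
    qed simp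
  qed
  then show ?thesis using first strong weak by blast
qed

end
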